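(* Let $\alpha\in\mathbb{C}\setminus\{-1,-2,\dots\}$ and let $k\ge 1$ be an integer. Then $$\sum_{j=1}^\infty \frac{1}{s_j^{2k}} = \frac{(-1)^{k+1}}{2^{2k}\,k!\,(\alpha+2)_{k-1}}\,\mathfrak{B}_{2k,\alpha}(1).$$ If, in addition, $\operatorname{Re}\alpha<2k-3/2$, then $$\sum_{j=1}^\infty \frac{1}{\mathcal{I}_\alpha(is_j)\,s_j^{2k}} = \frac{(-1)^{k+1}}{2^{2k}\,k!\,(\alpha+2)_{k-1}}\,\mathfrak{B}_{2k,\alpha}(0).$$
   Context: For $\alpha\in\mathbb{C}\setminus\{-1,-2,\dots\}$ let $\mathcal{I}_\alpha$ be the entire function $$\mathcal{I}_\alpha(z)=2^\alpha\Gamma(\alpha+1)\frac{J_\alpha(iz)}{(iz)^\alpha}=\Gamma(\alpha+1)\sum_{n=0}^\infty\frac{(z/2)^{2n}}{n!\,\Gamma(n+\alpha+1)},$$ where $J_\alpha$ is the Bessel function of order $\alpha$, and let $E_\alpha(z)=\mathcal{I}_\alpha(z)+\frac{z}{2(\alpha+1)}\mathcal{I}_{\alpha+1}(z)$. Write $(a)_n=a(a+1)\cdots(a+n-1)$ (with $(a)_0=1$) and $$\gamma_{2k,\alpha}=2^{2k}k!\,(\alpha+1)_k,\qquad \gamma_{2k+1,\alpha}=2^{2k+1}k!\,(\alpha+1)_{k+1},$$ so that $E_\alpha(z)=\sum_{n\ge0} z^n/\gamma_{n,\alpha}$. The Bernoulli-Dunkl polynomials $\mathfrak{B}_{n,\alpha}$,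 $n\ge 0$, are defined by the generating function (for $t$ near $0$) $$\frac{E_\alpha(xt)}{\mathcal{I}_{\alpha+1}(t)}=\sum_{n=0}^\infty\frac{\mathfrak{B}_{n,\alpha}(x)}{\gamma_{n,\alpha}}\,t^n.$$ The numbers $s_j=s_{j,\alpha}$, $j\in\mathbb{Z}\setminus\{0\}$, are the zeros (all nonzero and simple) of the even entire function $J_{\alpha+1}(x)/x^{\alpha+1}$, indexed so that $s_{-j}=-s_j$ and $0\le\operatorname{Re}s_j\le\operatorname{Re}s_{j+1}$ for $j\ge1$. *)

theory Defs
  imports "HOL-Complex_Analysis.Complex_Analysis"
begin

text \<open>Bessel function of the first kind, with the principal branch of the power.\<close>

definition bessel_J :: "complex \<Rightarrow> complex \<Rightarrow> complex" where
  "bessel_J \<nu> z = (z / 2) powr \<nu> *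
     (\<Sum>n. (-1) ^ n * (z / 2) ^ (2 * n) / (fact n * Gamma (of_nat n + \<nu> + 1)))"

text \<open>The entire function \<open>J\<^sub>\<nu>(z) / z\<^sup>\<nu>\<close>: at the removable singularity \<open>0\<close> it takes the limit value.
  The two principal powers cancel, so it does not depend on the choice of branch; see
  \<open>bessel_J_quot_series\<close> below.\<close>

definition bessel_J_quot :: "complex \<Rightarrow> complex \<Rightarrow> complex" where
  "bessel_J_quot \<nu> z =
     (if z = 0 then 1 / (2 powr \<nu> * Gamma (\<nu> + 1)) else bessel_J \<nu> z / z powr \<nu>)"

definition dunkl_I :: "complex \<Rightarrow> complex \<Rightarrow> complex" where
  "dunkl_I \<alpha> z =
     Gamma (\<alpha> + 1) * (\<Sum>n. (z / 2) ^ (2 * n) / (fact n * Gamma (of_nat n + \<alpha> + 1)))"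

definition dunkl_E :: "complex \<Rightarrow> complex \<Rightarrow> complex" where
  "dunkl_E \<alpha> z = dunkl_I \<alpha> z + z / (2 * (\<alpha> + 1)) * dunkl_I (\<alpha> + 1) z"

definition dunkl_gamma :: "complex \<Rightarrow> nat \<Rightarrow> complex" where
  "dunkl_gamma \<alpha> n =
     (let k = n div 2 in
      if even n then 2 ^ (2 * k) * fact k * pochhammer (\<alpha> + 1) k
      else 2 ^ (2 * k + 1) * fact k * pochhammer (\<alpha> + 1) (k + 1))"

text \<open>The value at \<open>x\<close> of the \<open>n\<close>-th Bernoulli-Dunkl polynomial, read off from the Taylor expansion
  at \<open>t = 0\<close> of the generating function; see \<open>bernoulli_dunkl_sums\<close> below.\<close>

definition bernoulli_dunkl :: "complex \<Rightarrow> nat \<Rightarrow> complex \<Rightarrow> complex" where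
  "bernoulli_dunkl \<alpha> n x = dunkl_gamma \<alpha> n *
     fps_nth (fps_expansion (\<lambda>t. dunkl_E \<alpha> (x * t) / dunkl_I (\<alpha> + 1) t) 0) n"


lemma bessel_J_quot_series:
  "bessel_J_quot \<nu> z = 2 powr (-\<nu>) *
     (\<Sum>n. (-1) ^ n * (z / 2) ^ (2 * n) / (fact n * Gamma (of_nat n + \<nu> + 1)))"
proof (cases "z = 0")
  case True
  have "(\<Sum>n. (-1) ^ n * (0 / 2 :: complex) ^ (2 * n) / (fact n * Gamma (of_nat n + \<nu> + 1)))
      = (\<Sum>n\<in>{0}. (-1) ^ n * (0 / 2 :: complex) ^ (2 * n) / (fact n * Gamma (of_nat n + \<nu> + 1)))"
    by (rule suminf_finite) (auto simp: power_0_left)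
  then show ?thesis
    using True by (simp add: bessel_J_quot_def powr_minus field_simps)
next
  case False
  have Ln: "Ln (z / 2) = Ln z - Ln 2"
    using Ln_divide_of_real[of 2 z] False by (simp add: Ln_of_real[of 2, simplified])
  have "(z / 2) powr \<nu> = z powr \<nu> * 2 powr (-\<nu>)"
    using False by (simp add: powr_def Ln right_diff_distrib flip: exp_add)
  then show ?thesis
    using False by (simp add: bessel_J_quot_def bessel_J_def)
qed

lemma dunkl_I_eq_bessel_J:
  assumes "z \<noteq> 0"
  shows "dunkl_I \<alpha> z =
    2 powr \<alpha> * Gamma (\<alpha> + 1) * (bessel_J \<alpha> (\<i> * z) / (\<i> * z) powr \<alpha>)"
proof -
  have "(-1) ^ n * (\<i> * z / 2) ^ (2 * n) = (z / 2) ^ (2 * n)" for n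
  proof -
    have "(\<i> * z / 2)\<^sup>2 = (-1) * (z / 2)\<^sup>2"
      by (simp add: power_divide power_mult_distrib)
    then show ?thesis
      unfolding power_mult by (simp only: power_mult_distrib mult.assoc[symmetric]) simp
  qed
  then have "bessel_J_quot \<alpha> (\<i> * z) = 2 powr (-\<alpha>) *
     (\<Sum>n. (z / 2) ^ (2 * n) / (fact n * Gamma (of_nat n + \<alpha> + 1)))"
    unfolding bessel_J_quot_series by simp
  moreover have "bessel_J_quot \<alpha> (\<i> * z) = bessel_J \<alpha> (\<i> * z) / (\<i> * z) powr \<alpha>"
    using assms by (simp add: bessel_J_quot_def)
  ultimately show ?thesis
    by (simp add: dunkl_I_def powr_minus)
qed

lemma summable_dunkl:
  "summable (\<lambda>n. w ^ n / (fact n * Gamma (of_nat n + \<alpha> + 1) :: complex))"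
proof -
  define f where "f n = w ^ n / (fact n * Gamma (of_nat n + \<alpha> + 1))" for n
  obtain N where N: "real N \<ge> norm \<alpha> + 2 * norm w"
    using real_arch_simple by blast
  have "norm (f (Suc n)) \<le> 1 / 2 * norm (f n)" if "n \<ge> N" for n
  proof -
    have n: "real n \<ge> norm \<alpha> + 2 * norm w" using N that by linarith
    define b where "b = of_nat n + \<alpha> + 1"
    have rG: "rGamma b = b * rGamma (b + 1)" by (simp add: rGamma_plus1)
    have "of_nat (Suc n) = b - \<alpha>" by (simp add: b_def)
    then have "real (Suc n) \<le> norm b + norm \<alpha>"
      using norm_triangle_ineq4[of b \<alpha>] norm_of_nat[of "Suc n", where 'a = complex] by metis
    then have b1: "norm b \<ge> 1"
      using n norm_ge_zero[of w] by linarith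
    have fn: "f n = w ^ n / fact n * (b * rGamma (b + 1))"
      unfolding rG[symmetric] by (simp add: f_def b_def rGamma_inverse_Gamma field_simps)
    have "f (Suc n) = w ^ Suc n / fact (Suc n) * rGamma (b + 1)"
      by (simp add: f_def b_def rGamma_inverse_Gamma field_simps)
    then have "norm (f (Suc n)) =
        (norm w / real (Suc n)) * (norm w ^ n / fact n * norm (rGamma (b + 1)))"
      by (simp add: norm_mult norm_divide norm_power del: of_nat_Suc)
    also have "\<dots> \<le> (1 / 2) * (norm w ^ n / fact n * (norm b * norm (rGamma (b + 1))))"
    proof (intro mult_mono)
      have "2 * norm w \<le> 1 + real n"
        using n norm_ge_zero[of \<alpha>] by linarith
      then show "norm w / real (Suc n) \<le> 1 / 2"
        by (simp add: field_simps)
      show "norm (rGamma (b + 1)) \<le> norm b * norm (rGamma (b + 1))"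
        using b1 mult_right_mono[of 1 "norm b" "norm (rGamma (b + 1))"] by simp
    qed auto
    also have "\<dots> = 1 / 2 * norm (f n)"
      by (simp add: fn norm_mult norm_divide norm_power)
    finally show ?thesis .
  qed
  then have "summable f" by (intro summable_ratio_test[of "1/2" N]) simp_all
  then show ?thesis unfolding f_def [abs_def] .
qed

lemma holomorphic_dunkl_I: "dunkl_I \<alpha> holomorphic_on UNIV"
proof -
  define F where "F = Abs_fps (\<lambda>n. 1 / (fact n * Gamma (of_nat n + \<alpha> + 1)))"
  have "summable (\<lambda>n. fps_nth F n * w ^ n)" for w
    using summable_dunkl[of w \<alpha>] by (simp add: F_def)
  then have "fps_conv_radius F = \<infinity>"
    unfolding fps_conv_radius_def by (intro conv_radius_inftyI'') auto
  then have "eval_fps F holomorphic_on UNIV"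
    by (intro holomorphic_on_eval_fps) auto
  then have "(\<lambda>z. eval_fps F ((z / 2) ^ 2)) holomorphic_on UNIV"
    by (rule holomorphic_on_compose_gen[of "\<lambda>z. (z / 2) ^ 2" UNIV "eval_fps F" UNIV, unfolded o_def, rotated])
       (auto intro!: holomorphic_intros)
  then have "(\<lambda>z. Gamma (\<alpha> + 1) * eval_fps F ((z / 2) ^ 2)) holomorphic_on UNIV"
    by (intro holomorphic_on_mult holomorphic_on_const)
  then show ?thesis
    by (rule holomorphic_transform) (simp add: dunkl_I_def eval_fps_def F_def power_mult)
qed

lemma dunkl_I_0:
  assumes "\<alpha> + 1 \<notin> \<int>\<^sub>\<le>\<^sub>0"
  shows "dunkl_I \<alpha> 0 = 1"
proof -
  have "(\<Sum>n. (0 / 2 :: complex) ^ (2 * n) / (fact n * Gamma (of_nat n + \<alpha> + 1)))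
      = (\<Sum>n\<in>{0}. (0 / 2 :: complex) ^ (2 * n) / (fact n * Gamma (of_nat n + \<alpha> + 1)))"
    by (rule suminf_finite) (auto simp: power_0_left)
  then show ?thesis
    using assms by (simp add: dunkl_I_def Gamma_eq_zero_iff)
qed

lemma plus_one_notin_nonpos_Ints:
  assumes "\<alpha> \<notin> {- of_nat m | m :: nat. m \<ge> 1}"
  shows "\<alpha> + 1 \<notin> \<int>\<^sub>\<le>\<^sub>0" "\<alpha> + 2 \<notin> (\<int>\<^sub>\<le>\<^sub>0 :: complex set)"
proof -
  have *: "\<alpha> + of_nat (Suc j) \<notin> \<int>\<^sub>\<le>\<^sub>0" for j
  proof
    assume "\<alpha> + of_nat (Suc j) \<in> \<int>\<^sub>\<le>\<^sub>0"
    then obtain m where "\<alpha> + of_nat (Suc j) = - of_nat m"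
      by (elim nonpos_Ints_cases')
    then have "\<alpha> = - of_nat (m + Suc j)"
      by (simp add: algebra_simps eq_neg_iff_add_eq_0)
    moreover have "m + Suc j \<ge> 1" by simp
    ultimately show False using assms by blast
  qed
  show "\<alpha> + 1 \<notin> \<int>\<^sub>\<le>\<^sub>0" "\<alpha> + 2 \<notin> \<int>\<^sub>\<le>\<^sub>0"
    using *[of 0] *[of 1] by (simp_all add: numeral_2_eq_2)
qed

lemma dunkl_gamma_nonzero:
  assumes "\<alpha> + 1 \<notin> \<int>\<^sub>\<le>\<^sub>0"
  shows "dunkl_gamma \<alpha> n \<noteq> 0"
proof -
  have "pochhammer (\<alpha> + 1) k \<noteq> 0" for k
    using assms by (auto simp: pochhammer_eq_0_iff)
  then show ?thesis
    by (simp add: dunkl_gamma_def Let_def)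
qed

lemma bernoulli_dunkl_sums:
  assumes "\<alpha> \<notin> {- of_nat m | m :: nat. m \<ge> 1}"
  shows "\<forall>\<^sub>F t in nhds 0.
    (\<lambda>n. bernoulli_dunkl \<alpha> n x / dunkl_gamma \<alpha> n * t ^ n) sums
      (dunkl_E \<alpha> (x * t) / dunkl_I (\<alpha> + 1) t)"
proof -
  note \<alpha> = plus_one_notin_nonpos_Ints[OF assms]
  define g where "g = (\<lambda>t. dunkl_E \<alpha> (x * t) / dunkl_I (\<alpha> + 1) t)"
  have hol: "(\<lambda>t. dunkl_I \<beta> (c * t)) holomorphic_on UNIV" for \<beta> c
    using holomorphic_on_compose_gen[OF _ holomorphic_dunkl_I, of "\<lambda>t. c * t" UNIV \<beta>]
    by (auto simp: o_def intro!: holomorphic_intros)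
  have I0: "dunkl_I (\<alpha> + 1) 0 = 1"
    using \<alpha> by (intro dunkl_I_0) (simp add: add.assoc)
  have "\<alpha> + 1 \<noteq> 0" using \<alpha> by auto
  then have "2 * (\<alpha> + 1) \<noteq> 0"
    unfolding mult_eq_0_iff by simp
  have an: "(\<lambda>t. dunkl_I \<beta> (c * t)) analytic_on {0}" for \<beta> c
    using hol analytic_on_holomorphic by blast
  have "g analytic_on {0}"
    unfolding g_def dunkl_E_def
    by (intro analytic_intros an an[of _ 1, simplified]) (use I0 \<open>2 * (\<alpha> + 1) \<noteq> 0\<close> in simp_all)
  then have "g has_fps_expansion fps_expansion g 0"
    by (rule analytic_at_imp_has_fps_expansion_0)
  then have rad: "fps_conv_radius (fps_expansion g 0) > 0"
    and ev: "\<forall>\<^sub>F t in nhds 0. eval_fps (fps_expansion g 0) t = g t"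
    by (simp_all add: has_fps_expansion_def)
  have "\<forall>\<^sub>F t in nhds 0. t \<in> eball 0 (fps_conv_radius (fps_expansion g 0))"
    using rad by (intro eventually_nhds_in_open) (auto simp: zero_ereal_def)
  with ev show ?thesis
  proof eventually_elim
    case (elim t)
    then have "(\<lambda>n. fps_nth (fps_expansion g 0) n * t ^ n) sums g t"
      using sums_eval_fps[of t "fps_expansion g 0"] by simp
    then show ?case
      using dunkl_gamma_nonzero[OF \<alpha>(1)] by (simp add: bernoulli_dunkl_def g_def)
  qed
qed

end

theory Submission
  imports Defs
begin

text \<open>Write \<open>I = \<I>\<^bsub>\<alpha>+1\<^esub>\<close> and integrate \<open>E\<^sub>\<alpha>(xt) / (I(t) t\<^bsup>2k+1\<^esup>)\<close> over growing squares centred at \<open>0\<close>.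
  The residue at \<open>0\<close> is the Bernoulli-Dunkl coefficient, and because
  \<open>\<I>\<^sub>\<alpha> = I + t / (2(\<alpha>+1)) I'\<close>, the residues at the zeros \<open>\<plusminus>\<i>s\<^sub>j\<close> of \<open>I\<close> are the terms of the two series.

  The required bounds on the squares come from a quantitative WKB argument: \<open>u(z) = z\<^bsup>p\<^esup> I(\<i>z)\<close> with
  \<open>p = \<alpha> + 3/2\<close> satisfies \<open>u'' = -(1 + c / z\<^sup>2) u\<close>, so along the sides of a square of half-width \<open>X\<close> the
  coefficients of \<open>u\<close> with respect to \<open>e\<^bsup>\<plusminus>\<i>z\<^esup>\<close> vary by \<open>O(1/X)\<close> only. Evenness of \<open>I\<close>, read off at
  \<open>z = \<plusminus>\<i>X\<close>, determines the ratio of the two coefficients, and hence the half-widths \<open>X\<^sub>N\<close> for which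
  the two exponentials add up without cancellation. The same estimates give \<open>|I'| \<ge> const |t|\<^bsup>-Re p\<^esup>\<close> at the zeros,
  and \<open>\<integral> I' / I\<close> counts the zeros, so both series converge absolutely.\<close>

subsection \<open>Contiguity relations and the differential equation\<close>

text \<open>The amplitude of the oscillation is never computed. It only has to stay away from 0,
  which follows because the solution is nontrivial and its two exponential coefficients keep their
  total size, up to a factor 2, along the real axis beyond \<open>X0\<close>. Off the axis the
  recessive exponential can only be tracked in directions in which it does not grow, so each part of
  a square is reached from the real axis outwards. The outcome is that u(z) resembles 2 D cos(z - pi
  p / 2); the vertical sides at Re z = pi Re p / 2 + pi N lie, in real part, midway between the
  expected zeros. As \<alpha> is complex, the zeros need not lie on a line, and they are ordered
  only by one coordinate. The squares give the sums block by block; absolute convergence turns these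
  limits into the sum in the prescribed order. The bound Re \<alpha> < 2k - 3/2 is Re p < 2k: it
  lets an integrand of size |t|^(Re p - 2k - 1) beat the length of the contour.\<close>

lemma dunkl_fps_conv_radius:
  assumes "\<alpha> + 1 \<notin> \<int>\<^sub>\<le>\<^sub>0"
  shows "fps_conv_radius (Abs_fps (\<lambda>n. 1 / (fact n * pochhammer (\<alpha> + 1) n) :: complex)) = \<infinity>"
proof -
  define F :: "complex fps" where "F = Abs_fps (\<lambda>n. 1 / (fact n * pochhammer (\<alpha> + 1) n))"
  have "summable (\<lambda>n. fps_nth F n * w ^ n)" for w
  proof -
    have "fps_nth F n * w ^ n = Gamma (\<alpha> + 1) * (w ^ n / (fact n * Gamma (of_nat n + \<alpha> + 1)))" for n
      using assms by (simp add: F_def pochhammer_Gamma add_ac)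
    then show ?thesis
      using summable_mult[OF summable_dunkl[of w \<alpha>], of "Gamma (\<alpha> + 1)"] by simp
  qed
  then show ?thesis
    unfolding fps_conv_radius_def F_def by (intro conv_radius_inftyI'') (auto simp: F_def)
qed

text \<open>This is the hypergeometric function 0F1(; \<alpha> + 1; w). In the variable w = (t/2)^2
  differentiation merely shifts \<alpha>, which makes zeros of neighbouring orders easy to
  compare.\<close>

definition dunkl_G :: "complex \<Rightarrow> complex \<Rightarrow> complex" where
  "dunkl_G \<alpha> = eval_fps (Abs_fps (\<lambda>n. 1 / (fact n * pochhammer (\<alpha> + 1) n)))"

lemma dunkl_I_eq_G:
  assumes "\<alpha> + 1 \<notin> \<int>\<^sub>\<le>\<^sub>0"
  shows "dunkl_I \<alpha> t = dunkl_G \<alpha> ((t / 2)\<^sup>2)"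
proof -
  have "Gamma (\<alpha> + 1) * (\<Sum>n. (t / 2) ^ (2 * n) / (fact n * Gamma (of_nat n + \<alpha> + 1))) =
     (\<Sum>n. Gamma (\<alpha> + 1) * ((t / 2) ^ (2 * n) / (fact n * Gamma (of_nat n + \<alpha> + 1))))"
    using summable_dunkl[of "(t / 2)\<^sup>2" \<alpha>] by (intro suminf_mult [symmetric]) (simp add: power_mult)
  also have "\<dots> = (\<Sum>n. 1 / (fact n * pochhammer (\<alpha> + 1) n) * ((t / 2)\<^sup>2) ^ n)"
    using assms by (intro suminf_cong) (simp add: pochhammer_Gamma add_ac flip: power_mult)
  finally show ?thesis
    by (simp add: dunkl_I_def dunkl_G_def eval_fps_def)
qed

lemma plus_one_notin_nonpos_Ints':
  "\<alpha> + 1 \<notin> \<int>\<^sub>\<le>\<^sub>0 \<Longrightarrow> \<alpha> + 1 + 1 \<notin> (\<int>\<^sub>\<le>\<^sub>0 :: complex set)"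
  by (metis add_diff_cancel_right' nonpos_Ints_diff_Nats Nats_1)

lemma DERIV_dunkl_G:
  assumes "\<alpha> + 1 \<notin> \<int>\<^sub>\<le>\<^sub>0"
  shows "(dunkl_G \<alpha> has_field_derivative dunkl_G (\<alpha> + 1) w / (\<alpha> + 1)) (at w)"
proof -
  have a0: "\<alpha> + 1 \<noteq> 0" using assms by auto
  define F where "F = (\<lambda>\<alpha>::complex. Abs_fps (\<lambda>n. 1 / (fact n * pochhammer (\<alpha> + 1) n)))"
  have "fps_deriv (F \<alpha>) = fps_const (1 / (\<alpha> + 1)) * F (\<alpha> + 1)"
  proof (rule fps_ext)
    fix n
    have "of_nat (Suc n) \<noteq> (0::complex)" by (rule of_nat_neq_0)
    then show "fps_nth (fps_deriv (F \<alpha>)) n = fps_nth (fps_const (1 / (\<alpha> + 1)) * F (\<alpha> + 1)) n"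
      by (simp add: F_def pochhammer_rec divide_simps del: of_nat_Suc)
  qed
  moreover have "(dunkl_G \<alpha> has_field_derivative eval_fps (fps_deriv (F \<alpha>)) w) (at w)"
    unfolding dunkl_G_def F_def by (rule has_field_derivative_eval_fps)
      (simp add: dunkl_fps_conv_radius[OF assms])
  moreover have "eval_fps (fps_const (1 / (\<alpha> + 1)) * F (\<alpha> + 1)) w = dunkl_G (\<alpha> + 1) w / (\<alpha> + 1)"
    using dunkl_fps_conv_radius[OF plus_one_notin_nonpos_Ints'[OF assms]]
    by (subst eval_fps_mult) (simp_all add: F_def dunkl_G_def)
  ultimately show ?thesis by simp
qed

text \<open>The three-term recurrence of the Bessel functions in the 0F1 normalisation, proved by
  comparing coefficients.\<close>

lemma dunkl_G_contiguous:
  assumes "\<alpha> + 1 \<notin> \<int>\<^sub>\<le>\<^sub>0"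
  shows "dunkl_G \<alpha> w = dunkl_G (\<alpha> + 1) w + w / ((\<alpha> + 1) * (\<alpha> + 2)) * dunkl_G (\<alpha> + 2) w"
proof -
  have a: "\<alpha> + 1 + 1 \<notin> \<int>\<^sub>\<le>\<^sub>0" "\<alpha> + 2 + 1 \<notin> \<int>\<^sub>\<le>\<^sub>0"
    using plus_one_notin_nonpos_Ints'[of "\<alpha>"] plus_one_notin_nonpos_Ints'[of "\<alpha> + 1"] assms
    by (simp_all add: add_ac)
  have a0: "\<alpha> + 1 \<noteq> 0" "\<alpha> + 2 \<noteq> 0" using assms a by (auto simp: add_ac)
  define F where "F = (\<lambda>\<alpha>::complex. Abs_fps (\<lambda>n. 1 / (fact n * pochhammer (\<alpha> + 1) n)))"
  have F: "fps_conv_radius (F \<alpha>) = \<infinity>" "fps_conv_radius (F (\<alpha> + 1)) = \<infinity>" "fps_conv_radius (F (\<alpha> + 2)) = \<infinity>"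
    using dunkl_fps_conv_radius assms a by (simp_all only: F_def)
  have "F \<alpha> = F (\<alpha> + 1) + fps_const (1 / ((\<alpha> + 1) * (\<alpha> + 2))) * fps_X * F (\<alpha> + 2)"
  proof (rule fps_ext)
    fix n
    have p: "pochhammer (\<alpha> + 1) n \<noteq> 0" "pochhammer (\<alpha> + 1 + 1) n \<noteq> 0" "pochhammer (\<alpha> + 2 + 1) n \<noteq> 0" for n
      using assms a by (auto simp: pochhammer_eq_0_iff)
    show "fps_nth (F \<alpha>) n = fps_nth (F (\<alpha> + 1) + fps_const (1 / ((\<alpha> + 1) * (\<alpha> + 2))) * fps_X * F (\<alpha> + 2)) n"
    proof (cases n)
      case (Suc k)
      define P where "P = pochhammer (\<alpha> + 3) k"
      have P: "P \<noteq> 0" using p(3)[of k] by (simp add: P_def add_ac)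
      have 3: "pochhammer (\<alpha> + 2 + 1) k = P" by (simp add: P_def add_ac)
      have 2: "pochhammer (\<alpha> + 1 + 1) (Suc k) = (\<alpha> + 2) * P"
        by (simp add: P_def pochhammer_rec add_ac)
      have 1: "pochhammer (\<alpha> + 1) (Suc k) * (\<alpha> + 2 + of_nat k) = (\<alpha> + 1) * ((\<alpha> + 2) * P)"
        using pochhammer_rec'[of "\<alpha> + 1" "Suc k"] pochhammer_rec[of "\<alpha> + 1" "Suc k"] 2 by (simp add: algebra_simps)
      then have e: "\<alpha> + 2 + of_nat k \<noteq> 0" using a0 P by auto
      have 1: "pochhammer (\<alpha> + 1) (Suc k) = (\<alpha> + 1) * ((\<alpha> + 2) * P) / (\<alpha> + 2 + of_nat k)"
        using 1 e by (simp add: field_simps)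
      have f: "(1 + of_nat k :: complex) \<noteq> 0" using of_nat_neq_0[of k] by simp
      \<comment> \<open>To be used with a = \<alpha> + 1, b = \<alpha> + 2, f = k + 1 and e =
        \<alpha> + 2 + k: the comparison of coefficients comes down to e = a + f.\<close>
      have *: "1 / ((f * g) * (a * (b * P) / e)) = 1 / ((f * g) * (b * P)) + 1 / (a * b) * (1 / (g * P))"
        if "a \<noteq> 0" "b \<noteq> 0" "e \<noteq> 0" "f \<noteq> 0" "g \<noteq> 0" "P \<noteq> 0" "e = a + f" for a b e f g P :: complex
        using that by (simp add: field_simps)
      have fact: "fact (Suc k) = (1 + of_nat k) * (fact k :: complex)" by simp
      have "fps_nth (fps_const (1 / ((\<alpha> + 1) * (\<alpha> + 2))) * fps_X * F (\<alpha> + 2)) (Suc k) =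
          1 / ((\<alpha> + 1) * (\<alpha> + 2)) * (1 / (fact k * P))"
        using 3 by (simp add: mult.assoc F_def)
      moreover have "fps_nth (F \<alpha>) (Suc k) = 1 / (((1 + of_nat k) * fact k) * ((\<alpha> + 1) * ((\<alpha> + 2) * P) / (\<alpha> + 2 + of_nat k)))"
        unfolding F_def fps_nth_Abs_fps 1 fact ..
      moreover have "fps_nth (F (\<alpha> + 1)) (Suc k) = 1 / (((1 + of_nat k) * fact k) * ((\<alpha> + 2) * P))"
        unfolding F_def fps_nth_Abs_fps 2 fact ..
      ultimately show ?thesis
        unfolding Suc fps_add_nth using *[OF a0 e f, of "fact k" P] P by simp
    qed (simp add: F_def mult.assoc)
  qed
  then have "eval_fps (F \<alpha>) w = eval_fps (F (\<alpha> + 1)) w +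
      eval_fps (fps_const (1 / ((\<alpha> + 1) * (\<alpha> + 2))) * fps_X * F (\<alpha> + 2)) w"
    using F fps_conv_radius_mult[of "fps_const (1 / ((\<alpha> + 1) * (\<alpha> + 2))) * fps_X" "F (\<alpha> + 2)"]
     fps_conv_radius_mult[of "fps_const (1 / ((\<alpha> + 1) * (\<alpha> + 2)))" "fps_X :: complex fps"]
    by (simp only:) (subst eval_fps_add, auto)
  also have "eval_fps (fps_const (1 / ((\<alpha> + 1) * (\<alpha> + 2))) * fps_X * F (\<alpha> + 2)) w =
      w / ((\<alpha> + 1) * (\<alpha> + 2)) * eval_fps (F (\<alpha> + 2)) w"
    using F fps_conv_radius_mult[of "fps_const (1 / ((\<alpha> + 1) * (\<alpha> + 2)))" "fps_X :: complex fps"]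
    by (subst eval_fps_mult; (subst eval_fps_mult)?) auto
  finally show ?thesis by (simp add: F_def dunkl_G_def)
qed

text \<open>The recurrence passes the zero at w on to all orders \<alpha> + n. These are, up to
  constants, the derivatives of \<open>dunkl_G \<alpha>\<close>, so the whole Taylor series at w
  would vanish, against the value 1 at 0.\<close>

lemma dunkl_G_not_both_zero:
  assumes "\<alpha> + 1 \<notin> \<int>\<^sub>\<le>\<^sub>0" "w \<noteq> 0" "dunkl_G \<alpha> w = 0" "dunkl_G (\<alpha> + 1) w = 0"
  shows False
proof -
  have notin: "\<alpha> + of_nat n + 1 \<notin> \<int>\<^sub>\<le>\<^sub>0" for n
  proof (induction n)
    case (Suc n)
    then show ?case using plus_one_notin_nonpos_Ints'[of "\<alpha> + of_nat n"] by (simp add: add_ac)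
  qed (use assms in auto)
  have zero: "dunkl_G (\<alpha> + of_nat n) w = 0 \<and> dunkl_G (\<alpha> + of_nat n + 1) w = 0" for n
  proof (induction n)
    case (Suc n)
    define \<beta> where "\<beta> = \<alpha> + of_nat n"
    have \<beta>: "\<beta> + 1 \<notin> \<int>\<^sub>\<le>\<^sub>0" "\<beta> + 1 + 1 \<notin> \<int>\<^sub>\<le>\<^sub>0"
      using notin[of n] plus_one_notin_nonpos_Ints' by (auto simp: \<beta>_def)
    then have "(\<beta> + 1) * (\<beta> + 2) \<noteq> 0" by (auto simp: add_ac)
    then have "dunkl_G (\<beta> + 2) w = 0"
      using dunkl_G_contiguous[OF \<beta>(1), of w] Suc assms(2) by (simp add: \<beta>_def)
    then show ?case using Suc by (simp add: \<beta>_def add_ac)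
  qed (use assms in auto)
  have holo: "dunkl_G \<alpha> holomorphic_on UNIV"
    using DERIV_dunkl_G[OF assms(1)] by (auto simp: holomorphic_on_open)
  have "\<exists>k. \<forall>w. (deriv ^^ n) (dunkl_G \<alpha>) w = k * dunkl_G (\<alpha> + of_nat n) w" for n
  proof (induction n)
    case (Suc n)
    then obtain k where "(deriv ^^ n) (dunkl_G \<alpha>) = (\<lambda>w. k * dunkl_G (\<alpha> + of_nat n) w)" by blast
    then have "(deriv ^^ Suc n) (dunkl_G \<alpha>) w = k * (dunkl_G (\<alpha> + of_nat n + 1) w / (\<alpha> + of_nat n + 1))" for w
      by (simp only: funpow.simps o_apply, intro DERIV_imp_deriv DERIV_cmult DERIV_dunkl_G notin)
    then show ?case by (intro exI[of _ "k / (\<alpha> + of_nat n + 1)"]) (simp add: add_ac)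
  qed (auto intro: exI[of _ 1])
  with zero have "(deriv ^^ n) (dunkl_G \<alpha>) w = 0" for n by (metis mult_zero_right)
  then have "dunkl_G \<alpha> 0 = 0"
    using holomorphic_fun_eq_0_on_connected[OF holo] by auto
  then show False by (simp add: dunkl_G_def eval_fps_at_0)
qed

lemma DERIV_dunkl_I:
  assumes "\<alpha> + 1 \<notin> \<int>\<^sub>\<le>\<^sub>0"
  shows "(dunkl_I \<alpha> has_field_derivative t / (2 * (\<alpha> + 1)) * dunkl_I (\<alpha> + 1) t) (at t)"
proof -
  have eq: "dunkl_I \<alpha> = (\<lambda>t. dunkl_G \<alpha> ((t / 2)\<^sup>2))"
    by (rule ext) (rule dunkl_I_eq_G[OF assms])
  have "(dunkl_I \<alpha> has_field_derivative
     dunkl_G (\<alpha> + 1) ((t / 2)\<^sup>2) / (\<alpha> + 1) * (t / 2)) (at t)"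
    unfolding eq by (rule DERIV_chain2[OF DERIV_dunkl_G[OF assms]])
       (auto intro!: derivative_eq_intros)
  then show ?thesis
    using dunkl_I_eq_G[OF plus_one_notin_nonpos_Ints'[OF assms]] by (simp add: mult.commute)
qed

text \<open>The recurrence for \<open>dunkl_G\<close> with the term of order \<alpha> + 2 read as a
  derivative. At a zero of \<open>dunkl_I (\<alpha> + 1)\<close> only the derivative term
  survives.\<close>

lemma dunkl_I_contiguous:
  assumes "\<alpha> + 1 \<notin> \<int>\<^sub>\<le>\<^sub>0"
  shows "dunkl_I \<alpha> t = dunkl_I (\<alpha> + 1) t + t / (2 * (\<alpha> + 1)) * deriv (dunkl_I (\<alpha> + 1)) t"
proof -
  have a: "\<alpha> + 1 + 1 \<notin> \<int>\<^sub>\<le>\<^sub>0" "\<alpha> + 2 + 1 \<notin> \<int>\<^sub>\<le>\<^sub>0"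
    using plus_one_notin_nonpos_Ints'[of "\<alpha>"] plus_one_notin_nonpos_Ints'[of "\<alpha> + 1"] assms
    by (simp_all add: add_ac)
  have d: "deriv (dunkl_I (\<alpha> + 1)) t = t / (2 * (\<alpha> + 2)) * dunkl_I (\<alpha> + 2) t"
    using DERIV_imp_deriv[OF DERIV_dunkl_I[OF a(1), of t]] by (simp add: add_ac)
  have "\<alpha> + 1 \<noteq> 0" "\<alpha> + 2 \<noteq> 0" using assms a by (auto simp: add_ac)
  then show ?thesis
    unfolding d dunkl_I_eq_G[OF assms] dunkl_I_eq_G[OF a(1)] dunkl_I_eq_G[OF a(2)] dunkl_G_contiguous[OF assms]
    by (simp add: power2_eq_square mult_ac del: distrib_left_numeral distrib_right_numeral)
qed

text \<open>The derivative is t times a nonzero multiple of the function of the next order, and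
  neighbouring orders share no zero.\<close>

lemma dunkl_I_zero_simple:
  assumes "\<alpha> + 1 \<notin> \<int>\<^sub>\<le>\<^sub>0" "dunkl_I \<alpha> t = 0"
  shows "t \<noteq> 0" "deriv (dunkl_I \<alpha>) t \<noteq> 0"
proof -
  show t: "t \<noteq> 0" using dunkl_I_0 assms by auto
  note a = plus_one_notin_nonpos_Ints'[OF assms(1)]
  have "\<alpha> + 1 \<noteq> 0" using assms(1) by auto
  then have "t / (2 * (\<alpha> + 1)) \<noteq> 0" using t unfolding divide_eq_0_iff mult_eq_0_iff by simp
  moreover have "dunkl_I (\<alpha> + 1) t \<noteq> 0"
    using dunkl_G_not_both_zero[OF assms(1), of "(t / 2)\<^sup>2"] t assms
    by (auto simp: dunkl_I_eq_G[OF assms(1)] dunkl_I_eq_G[OF a])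
  ultimately show "deriv (dunkl_I \<alpha>) t \<noteq> 0"
    unfolding DERIV_imp_deriv[OF DERIV_dunkl_I[OF assms(1)]] mult_eq_0_iff by blast
qed

lemma dunkl_I_minus: "dunkl_I \<alpha> (- t) = dunkl_I \<alpha> t"
  by (simp add: dunkl_I_def)

text \<open>The modified Bessel equation y'' + (2 \<nu> + 1) y' / t = y. It results from
  differentiating y' = t / (2 (\<nu> + 1)) I1 and eliminating the derivative of I1 by
  contiguity.\<close>

lemma DERIV_deriv_dunkl_I:
  assumes "\<nu> + 1 \<notin> \<int>\<^sub>\<le>\<^sub>0" "t \<noteq> 0"
  shows "(deriv (dunkl_I \<nu>) has_field_derivative dunkl_I \<nu> t - (2 * \<nu> + 1) / t * deriv (dunkl_I \<nu>) t) (at t)"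
proof -
  define I1 where "I1 = dunkl_I (\<nu> + 1)"
  note a = plus_one_notin_nonpos_Ints'[OF assms(1)]
  have n0: "\<nu> + 1 \<noteq> 0" using assms(1) by auto
  have d: "deriv (dunkl_I \<nu>) = (\<lambda>t. t / (2 * (\<nu> + 1)) * I1 t)"
    unfolding I1_def using DERIV_imp_deriv[OF DERIV_dunkl_I[OF assms(1)]] by blast
  have I1: "(I1 has_field_derivative deriv I1 t) (at t)" for t
    unfolding I1_def using DERIV_dunkl_I[OF a] DERIV_imp_deriv by metis
  define n where "n = \<nu> + 1"
  have n: "n \<noteq> 0" "2 * \<nu> + 1 = 2 * n - 1" using n0 by (simp_all add: n_def)
  have "(deriv (dunkl_I \<nu>) has_field_derivative (I1 t / (2 * n) + t / (2 * n) * deriv I1 t)) (at t)"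
    unfolding d n_def[symmetric] using n by (auto intro!: derivative_eq_intros I1 simp: field_simps)
  moreover have "dunkl_I \<nu> t = I1 t + t / (2 * n) * deriv I1 t"
    using dunkl_I_contiguous[OF assms(1)] by (simp add: I1_def n_def)
  moreover have "deriv (dunkl_I \<nu>) t = t / (2 * n) * I1 t" by (simp add: d n_def)
  moreover have "I1 t + t / (2 * n) * deriv I1 t - (2 * n - 1) / t * (t / (2 * n) * I1 t) =
      I1 t / (2 * n) + t / (2 * n) * deriv I1 t"
    using n assms by (simp add: field_simps)
  ultimately show ?thesis unfolding n(2) by (simp only:)
qed

subsection \<open>Asymptotics of the normal form\<close>

text \<open>The size |a| + |b| attains its maximum at some r, and over [0, L] each component leaves
  its unperturbed course by at most \<epsilon> L times this maximum. As \<epsilon> L \<le> 1/4, the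
  maximum is absorbed and is at most twice the initial size; no Gronwall estimate enters.\<close>

lemma perturbed_diagonal_system:
  fixes a b ea eb :: "real \<Rightarrow> complex" and \<mu> :: complex
  assumes L: "0 \<le> L"
    and da: "\<And>s. s \<in> {0..L} \<Longrightarrow> (a has_vector_derivative \<mu> * a s + ea s) (at s within {0..L})"
    and db: "\<And>s. s \<in> {0..L} \<Longrightarrow> (b has_vector_derivative eb s) (at s within {0..L})"
    and ea: "\<And>s. s \<in> {0..L} \<Longrightarrow> norm (ea s) \<le> \<epsilon> * (norm (a s) + norm (b s))"
    and eb: "\<And>s. s \<in> {0..L} \<Longrightarrow> norm (eb s) \<le> \<epsilon> * (norm (a s) + norm (b s))"
    and \<mu>: "Re \<mu> \<le> 0" and \<epsilon>: "0 \<le> \<epsilon>" "\<epsilon> * L \<le> 1 / 4"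
    and s: "s \<in> {0..L}"
  shows "norm (a s - exp (\<mu> * s) * a 0) \<le> 2 * \<epsilon> * L * (norm (a 0) + norm (b 0))"
    and "norm (b s - b 0) \<le> 2 * \<epsilon> * L * (norm (a 0) + norm (b 0))"
proof -
  define m where "m = (\<lambda>s. norm (a s) + norm (b s))"
  have "continuous_on {0..L} a" "continuous_on {0..L} b"
    using continuous_on_vector_derivative[OF da] continuous_on_vector_derivative[OF db] by auto
  then have "continuous_on {0..L} m"
    unfolding m_def by (intro continuous_intros)
  then obtain r where r: "r \<in> {0..L}" "\<And>s. s \<in> {0..L} \<Longrightarrow> m s \<le> m r"
    using continuous_attains_sup[of "{0..L}" m] L by auto
  have m0: "0 \<le> m s" for s by (simp add: m_def)
  have bd: "norm (b s - b 0) \<le> \<epsilon> * L * m r" if s: "s \<in> {0..L}" for s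
  proof -
    have "norm (b s - b 0) \<le> \<epsilon> * m r * norm (s - 0)"
    proof (rule differentiable_bound[of "{0..L}" b "\<lambda>x h. h *\<^sub>R eb x"])
      show "(b has_derivative (\<lambda>h. h *\<^sub>R eb x)) (at x within {0..L})" if "x \<in> {0..L}" for x
        using db[OF that] by (simp add: has_vector_derivative_def)
      show "onorm (\<lambda>h. h *\<^sub>R eb x) \<le> \<epsilon> * m r" if "x \<in> {0..L}" for x
      proof (rule onorm_le)
        have "norm (eb x) \<le> \<epsilon> * m r"
          using eb[OF that] mult_left_mono[OF r(2)[OF that] \<epsilon>(1)] by (simp add: m_def)
        then show "norm (h *\<^sub>R eb x) \<le> \<epsilon> * m r * norm h" for h
          by (simp add: mult.commute mult_left_mono)
      qed
    qed (use s in auto)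
    also have "\<dots> \<le> \<epsilon> * m r * L"
      using s m0 \<epsilon> by (intro mult_left_mono) auto
    finally show ?thesis by (simp add: mult_ac)
  qed
  have ad: "norm (a s - exp (\<mu> * s) * a 0) \<le> \<epsilon> * L * m r" if s: "s \<in> {0..L}" for s
  proof -
    let ?g = "\<lambda>x. exp (- \<mu> * of_real x) * a x"
    have "norm (?g s - ?g 0) \<le> exp (- Re \<mu> * s) * (\<epsilon> * m r) * norm (s - 0)"
    proof (rule differentiable_bound[of "{0..s}" ?g "\<lambda>x h. h *\<^sub>R (exp (- \<mu> * of_real x) * ea x)"])
      fix x assume x: "x \<in> {0..s}"
      then have x': "x \<in> {0..L}" using s by auto
      have "(?g has_vector_derivative exp (- \<mu> * of_real x) * (\<mu> * a x + ea x)
             + (- \<mu> * exp (- \<mu> * of_real x)) * a x) (at x within {0..s})"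
      proof (rule has_vector_derivative_mult)
        show "((\<lambda>x. exp (- \<mu> * of_real x)) has_vector_derivative - \<mu> * exp (- \<mu> * of_real x))
              (at x within {0..s})"
          by (rule has_vector_derivative_real_field) (auto intro!: derivative_eq_intros)
        show "(a has_vector_derivative \<mu> * a x + ea x) (at x within {0..s})"
          by (rule has_vector_derivative_within_subset[OF da[OF x']]) (use s in auto)
      qed
      then show "(?g has_derivative (\<lambda>h. h *\<^sub>R (exp (- \<mu> * of_real x) * ea x))) (at x within {0..s})"
        by (simp add: has_vector_derivative_def algebra_simps)
      have "exp (- Re \<mu> * x) \<le> exp (- Re \<mu> * s)"
        using x \<mu> by (simp add: mult_left_mono_neg)
      moreover have "norm (ea x) \<le> \<epsilon> * m r"
        using ea[OF x'] mult_left_mono[OF r(2)[OF x'] \<epsilon>(1)] by (simp add: m_def)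
      ultimately have "norm (exp (- \<mu> * of_real x) * ea x) \<le> exp (- Re \<mu> * s) * (\<epsilon> * m r)"
        unfolding norm_mult norm_exp_eq_Re by (intro mult_mono) auto
      then show "onorm (\<lambda>h. h *\<^sub>R (exp (- \<mu> * of_real x) * ea x)) \<le> exp (- Re \<mu> * s) * (\<epsilon> * m r)"
        by (intro onorm_le) (simp add: mult.commute mult_left_mono)
    qed (use s in auto)
    \<comment> \<open>Since Re \<mu> \<le> 0, the integrating factor is largest at the end point s,
      where multiplying by exp(\<mu> s) removes it exactly.\<close>
    then have "norm (exp (\<mu> * s)) * norm (?g s - ?g 0) \<le>
        norm (exp (\<mu> * s)) * (exp (- Re \<mu> * s) * (\<epsilon> * m r) * s)"
      using s by (intro mult_left_mono) auto
    also have "\<dots> = \<epsilon> * m r * s"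
      by (simp add: exp_minus field_simps)
    also have "\<dots> \<le> \<epsilon> * m r * L"
      using s m0 \<epsilon> by (intro mult_left_mono) auto
    also have "norm (exp (\<mu> * s)) * norm (?g s - ?g 0) = norm (a s - exp (\<mu> * s) * a 0)"
      unfolding norm_mult[symmetric] by (simp add: right_diff_distrib exp_minus flip: mult.assoc)
    finally show ?thesis by (simp add: mult_ac)
  qed
  have "norm (exp (\<mu> * r)) \<le> 1"
    using \<mu> r by (simp add: mult_nonpos_nonneg)
  then have "norm (exp (\<mu> * r) * a 0) \<le> norm (a 0)"
    by (simp add: norm_mult mult_left_le_one_le)
  then have "m r \<le> m 0 + 2 * (\<epsilon> * L * m r)"
    using ad[OF r(1)] bd[OF r(1)] norm_triangle_sub[of "a r" "exp (\<mu> * r) * a 0"]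
      norm_triangle_sub[of "b r" "b 0"]
    unfolding m_def by linarith
  moreover have "\<epsilon> * L * m r \<le> 1 / 4 * m r"
    using \<epsilon> m0 by (intro mult_right_mono) auto
  ultimately have "m r \<le> 2 * m 0" by linarith
  then have "\<epsilon> * L * m r \<le> \<epsilon> * L * (2 * m 0)"
    using \<epsilon> L by (intro mult_left_mono) auto
  then show "norm (a s - exp (\<mu> * s) * a 0) \<le> 2 * \<epsilon> * L * (norm (a 0) + norm (b 0))"
    and "norm (b s - b 0) \<le> 2 * \<epsilon> * L * (norm (a 0) + norm (b 0))"
    using ad[OF s] bd[OF s] by (simp_all add: m_def mult_ac)
qed

text \<open>\<open>u1\<close> is the derivative of \<open>u\<close>, and the cut along the negative
  axis makes room for a principal power z^p in \<open>u\<close>. \<open>reflect\<close> expresses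
  that u(z) / z^p is even on the imaginary axis, where (ix)^p and (-ix)^p differ from x^p by the two
  exponential factors. \<open>nontriv\<close> rules out the zero solution.\<close>

locale bessel_normal_form =
  fixes u u1 :: "complex \<Rightarrow> complex" and c p :: complex
  assumes du: "z \<notin> \<real>\<^sub>\<le>\<^sub>0 \<Longrightarrow> (u has_field_derivative u1 z) (at z)"
    and du1: "z \<notin> \<real>\<^sub>\<le>\<^sub>0 \<Longrightarrow> (u1 has_field_derivative - (1 + c / z\<^sup>2) * u z) (at z)"
    and reflect: "x > 0 \<Longrightarrow> exp (- (\<i> * pi * p / 2)) * u (\<i> * of_real x) = exp (\<i> * pi * p / 2) * u (- \<i> * of_real x)"
    and nontriv: "x > 0 \<Longrightarrow> u (of_real x) \<noteq> 0 \<or> u1 (of_real x) \<noteq> 0"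
begin

text \<open>Variation of constants: if u = a exp(iz) + b exp(-iz) and u1 is the corresponding
  derivative, then \<open>W 1\<close> is b and \<open>W (-1)\<close> is a. So
  \<open>W \<sigma>\<close> is the coefficient of exp(-i \<sigma> z), the dominant exponential where
  \<sigma> Im z > 0.\<close>

definition W :: "real \<Rightarrow> complex \<Rightarrow> complex" where
  "W \<sigma> z = exp (\<i> * \<sigma> * z) * (u z + \<i> * \<sigma> * u1 z) / 2"

text \<open>The recessive part of u, scaled by the same factor as the dominant one, so that no
  growing exponential remains where \<sigma> Im z \<ge> 0.\<close>

definition V :: "real \<Rightarrow> complex \<Rightarrow> complex" where
  "V \<sigma> z = exp (\<i> * \<sigma> * z) * (u z - \<i> * \<sigma> * u1 z) / 2"

lemma V_eq_W: "V \<sigma> z = exp (2 * \<i> * \<sigma> * z) * W (- \<sigma>) z"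
proof -
  have "exp (2 * \<i> * \<sigma> * z) = exp (\<i> * \<sigma> * z) * exp (\<i> * \<sigma> * z)"
    by (simp add: mult_ac flip: exp_add)
  then show ?thesis by (simp add: V_def W_def exp_minus field_simps)
qed

lemma u_eq: "exp (\<i> * \<sigma> * z) * u z = W \<sigma> z + V \<sigma> z"
  by (simp add: W_def V_def field_simps)

lemma u1_eq: "exp (\<i> * \<sigma> * z) * (\<i> * \<sigma> * u1 z) = W \<sigma> z - V \<sigma> z"
  by (simp add: W_def V_def field_simps)

context
  fixes \<sigma> :: real
  assumes \<sigma>: "\<sigma> = 1 \<or> \<sigma> = -1"
begin

lemma DERIV_W:
  assumes "z \<notin> \<real>\<^sub>\<le>\<^sub>0"
  shows "(W \<sigma> has_field_derivative - (\<i> * \<sigma> * c / (2 * z\<^sup>2)) * (W \<sigma> z + V \<sigma> z)) (at z)"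
proof -
  have "z \<noteq> 0" using assms by auto
  have "(W \<sigma> has_field_derivative
     (exp (\<i> * \<sigma> * z) * (u1 z + \<i> * \<sigma> * (- (1 + c / z\<^sup>2) * u z))
      + \<i> * \<sigma> * exp (\<i> * \<sigma> * z) * (u z + \<i> * \<sigma> * u1 z)) / 2) (at z)"
    unfolding W_def [abs_def]
    by (rule derivative_eq_intros du du1 assms refl | simp add: field_simps)+
  moreover have "(exp (\<i> * \<sigma> * z) * (u1 z + \<i> * \<sigma> * (- (1 + c / z\<^sup>2) * u z))
      + \<i> * \<sigma> * exp (\<i> * \<sigma> * z) * (u z + \<i> * \<sigma> * u1 z)) / 2 =
     - (\<i> * \<sigma> * c / (2 * z\<^sup>2)) * (exp (\<i> * \<sigma> * z) * u z)"
    using \<sigma> \<open>z \<noteq> 0\<close> by (auto simp: field_simps)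
  ultimately show ?thesis by (simp only: u_eq)
qed

lemma DERIV_V:
  assumes "z \<notin> \<real>\<^sub>\<le>\<^sub>0"
  shows "(V \<sigma> has_field_derivative
    2 * \<i> * \<sigma> * V \<sigma> z + \<i> * \<sigma> * c / (2 * z\<^sup>2) * (W \<sigma> z + V \<sigma> z)) (at z)"
proof -
  have "z \<noteq> 0" using assms by auto
  have "(V \<sigma> has_field_derivative
     (exp (\<i> * \<sigma> * z) * (u1 z - \<i> * \<sigma> * (- (1 + c / z\<^sup>2) * u z))
      + \<i> * \<sigma> * exp (\<i> * \<sigma> * z) * (u z - \<i> * \<sigma> * u1 z)) / 2) (at z)"
    unfolding V_def [abs_def]
    by (rule derivative_eq_intros du du1 assms refl | simp add: field_simps)+
  moreover have "(exp (\<i> * \<sigma> * z) * (u1 z - \<i> * \<sigma> * (- (1 + c / z\<^sup>2) * u z))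
      + \<i> * \<sigma> * exp (\<i> * \<sigma> * z) * (u z - \<i> * \<sigma> * u1 z)) / 2 =
     2 * \<i> * \<sigma> * V \<sigma> z + \<i> * \<sigma> * c / (2 * z\<^sup>2) * (exp (\<i> * \<sigma> * z) * u z)"
    using \<sigma> \<open>z \<noteq> 0\<close> by (auto simp: V_def field_simps)
  ultimately show ?thesis by (simp only: u_eq)
qed

text \<open>\<open>Re (\<i> * \<sigma> * d) \<le> 0\<close> means that moving along d does not
  decrease \<sigma> Im z, so the factor exp(2 i \<sigma> z) of the recessive part does not grow. At
  distance at least X from 0 the perturbation is at most norm c / (2 X^2), and
  \<open>perturbed_diagonal_system\<close> applies.\<close>

lemma segment_bound:
  fixes z d :: complex
  assumes d: "norm d = 1" "Re (\<i> * \<sigma> * d) \<le> 0" and "X > 0" "L \<ge> 0"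
    and small: "norm c * L / (2 * X\<^sup>2) \<le> 1 / 4"
    and path: "\<And>s. s \<in> {0..L} \<Longrightarrow> z + d * s \<notin> \<real>\<^sub>\<le>\<^sub>0 \<and> norm (z + d * s) \<ge> X"
  shows "norm (V \<sigma> (z + d * L) - exp (2 * \<i> * \<sigma> * d * L) * V \<sigma> z) \<le>
           norm c * L / X\<^sup>2 * (norm (V \<sigma> z) + norm (W \<sigma> z)) \<and>
         norm (W \<sigma> (z + d * L) - W \<sigma> z) \<le>
           norm c * L / X\<^sup>2 * (norm (V \<sigma> z) + norm (W \<sigma> z))"
proof -
  define \<epsilon> where "\<epsilon> = norm c / (2 * X\<^sup>2)"
  define err where "err = (\<lambda>s::real. \<i> * \<sigma> * d * c / (2 * (z + d * s)\<^sup>2) * (W \<sigma> (z + d * s) + V \<sigma> (z + d * s)))"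
  have err: "norm (err s) \<le> \<epsilon> * (norm (V \<sigma> (z + d * s)) + norm (W \<sigma> (z + d * s)))" if "s \<in> {0..L}" for s
  proof -
    have "norm c / (2 * (norm (z + d * s))\<^sup>2) \<le> \<epsilon>"
      unfolding \<epsilon>_def using path[OF that] \<open>X > 0\<close> by (intro divide_left_mono mult_left_mono power_mono mult_pos_pos) auto
    moreover have "norm (W \<sigma> (z + d * s) + V \<sigma> (z + d * s)) \<le> norm (V \<sigma> (z + d * s)) + norm (W \<sigma> (z + d * s))"
      using norm_triangle_ineq add.commute by metis
    ultimately have "norm c / (2 * (norm (z + d * s))\<^sup>2) * norm (W \<sigma> (z + d * s) + V \<sigma> (z + d * s))
      \<le> \<epsilon> * (norm (V \<sigma> (z + d * s)) + norm (W \<sigma> (z + d * s)))"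
      by (intro mult_mono) (auto simp: \<epsilon>_def)
    moreover have "norm (err s) = norm c / (2 * (norm (z + d * s))\<^sup>2) * norm (W \<sigma> (z + d * s) + V \<sigma> (z + d * s))"
      using \<sigma> d by (auto simp: err_def norm_mult norm_divide norm_power)
    ultimately show ?thesis by simp
  qed
  have line: "((\<lambda>s. z + d * of_real s) has_vector_derivative d) (at s within S)" for s S
    by (auto intro!: derivative_eq_intros has_vector_derivative_real_field)
  have dV: "((\<lambda>s. V \<sigma> (z + d * of_real s)) has_vector_derivative
      (2 * \<i> * \<sigma> * d) * V \<sigma> (z + d * s) + err s) (at s within {0..L})" if "s \<in> {0..L}" for s
  proof -
    have "((V \<sigma> \<circ> (\<lambda>s. z + d * of_real s)) has_vector_derivative
       d * (2 * \<i> * \<sigma> * V \<sigma> (z + d * s) + \<i> * \<sigma> * c / (2 * (z + d * s)\<^sup>2) * (W \<sigma> (z + d * s) + V \<sigma> (z + d * s))))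
       (at s within {0..L})"
      by (rule field_vector_diff_chain_within[OF line DERIV_V[THEN has_field_derivative_at_within]])
        (use path[OF that] in auto)
    then show ?thesis by (simp add: o_def err_def algebra_simps)
  qed
  have dW: "((\<lambda>s. W \<sigma> (z + d * of_real s)) has_vector_derivative - err s) (at s within {0..L})"
    if "s \<in> {0..L}" for s
  proof -
    have "((W \<sigma> \<circ> (\<lambda>s. z + d * of_real s)) has_vector_derivative
       d * (- (\<i> * \<sigma> * c / (2 * (z + d * s)\<^sup>2)) * (W \<sigma> (z + d * s) + V \<sigma> (z + d * s))))
       (at s within {0..L})"
      by (rule field_vector_diff_chain_within[OF line DERIV_W[THEN has_field_derivative_at_within]])
        (use path[OF that] in auto)
    then show ?thesis by (simp add: o_def err_def algebra_simps)
  qed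
  have \<mu>: "Re (2 * \<i> * \<sigma> * d) \<le> 0"
    using d(2) by simp
  have \<epsilon>0: "0 \<le> \<epsilon>" "\<epsilon> * L \<le> 1 / 4" using small by (simp_all add: \<epsilon>_def)
  have eq: "2 * \<epsilon> * L = norm c * L / X\<^sup>2" by (simp add: \<epsilon>_def)
  note * = perturbed_diagonal_system[where a = "\<lambda>s. V \<sigma> (z + d * of_real s)" and b = "\<lambda>s. W \<sigma> (z + d * of_real s)"
      and eb = "\<lambda>s. - err s" and s = L, OF \<open>L \<ge> 0\<close> dV dW err, unfolded norm_minus_cancel, OF _ _ _ err \<mu> \<epsilon>0,
      unfolded eq]
  show ?thesis
    using *[simplified] \<open>L \<ge> 0\<close> by auto
qed

end

section \<open>Size of the coefficients on the real axis and along the sides of a square\<close>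

definition m :: "real \<Rightarrow> real" where
  "m x = norm (W 1 x) + norm (W (-1) x)"

text \<open>For X \<ge> X0 this gives norm c / X \<le> 1/4, the smallness condition for segments of
  length up to X.\<close>

definition X0 :: real where "X0 = 4 * norm c + 1"

lemma norm_V_real: "norm (V \<sigma> (of_real x)) = norm (W (- \<sigma>) (of_real x))"
  by (simp add: V_eq_W norm_mult norm_exp_eq_Re)

lemma m_eq:
  assumes "\<sigma> = 1 \<or> \<sigma> = -1"
  shows "m x = norm (V \<sigma> x) + norm (W \<sigma> x)"
  using assms unfolding norm_V_real by (auto simp: m_def)

lemma m_pos:
  assumes "x > 0" shows "m x > 0"
proof -
  have "m x \<noteq> 0"
  proof
    assume "m x = 0"
    then have "V 1 x = 0" "W 1 x = 0"
      using m_eq[of 1 x] by (simp_all add: add_nonneg_eq_0_iff)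
    then have "u x = 0" "u1 x = 0"
      using u_eq[of 1 x] u1_eq[of 1 x] by auto
    then show False using nontriv[OF assms] by auto
  qed
  moreover have "m x \<ge> 0" by (simp add: m_def)
  ultimately show ?thesis by linarith
qed

text \<open>The substitution \<open>x = 1 / (1 / X0 - s)\<close> absorbs the decay of the perturbation \<open>c / x\<^sup>2\<close>
  and maps \<open>[X0, \<infinity>)\<close> to a bounded interval.\<close>

lemma m_bounds:
  assumes "X \<ge> X0"
  shows "m X0 / 2 \<le> m X" and "m X \<le> 2 * m X0"
proof -
  define L where "L = 1 / X0 - 1 / X"
  have X0: "X0 \<ge> 1" "norm c \<le> X0 / 4" by (simp_all add: X0_def)
  have X: "X > 0" using assms X0 by linarith
  have L: "0 \<le> L" "L < 1 / X0" using assms X0 X by (simp_all add: L_def field_simps)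
  define x where "x = (\<lambda>s. 1 / (1 / X0 - s))"
  have x0: "x s > 0" if "s \<in> {0..L}" for s using that L by (simp add: x_def)
  have ends: "x 0 = X0" "x L = X" by (simp_all add: x_def L_def)
  have dx: "((\<lambda>s. complex_of_real (x s)) has_vector_derivative complex_of_real ((x s)\<^sup>2)) (at s within {0..L})"
    if "s \<in> {0..L}" for s
  proof (rule has_vector_derivative_of_real)
    have "1 / X0 - s \<noteq> 0" using that L by auto
    then show "(x has_real_derivative (x s)\<^sup>2) (at s within {0..L})"
      unfolding x_def by (auto intro!: derivative_eq_intros simp: power2_eq_square)
  qed
  define err where "err = (\<lambda>\<sigma> s::real. - (\<i> * complex_of_real \<sigma> * c / 2) * (W \<sigma> (x s) + V \<sigma> (x s)))"
  have dW: "((\<lambda>s. W \<sigma> (x s)) has_vector_derivative err \<sigma> s) (at s within {0..L})"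
    if "s \<in> {0..L}" and \<sigma>: "\<sigma> = 1 \<or> \<sigma> = -1" for s \<sigma>
  proof -
    have "((W \<sigma> \<circ> (\<lambda>s. complex_of_real (x s))) has_vector_derivative
       complex_of_real ((x s)\<^sup>2) * (- (\<i> * \<sigma> * c / (2 * (complex_of_real (x s))\<^sup>2)) * (W \<sigma> (x s) + V \<sigma> (x s))))
       (at s within {0..L})"
      by (rule field_vector_diff_chain_within[OF dx DERIV_W[THEN has_field_derivative_at_within]])
        (use x0[OF that(1)] that \<sigma> in auto)
    moreover have "complex_of_real ((x s)\<^sup>2) * (- (\<i> * \<sigma> * c / (2 * (complex_of_real (x s))\<^sup>2)) * w) = - (\<i> * complex_of_real \<sigma> * c / 2) * w" for w
      using x0[OF that(1)] by simp
    ultimately show ?thesis by (simp only: o_def err_def)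
  qed
  have err: "norm (err \<sigma> s) \<le> norm c / 2 * (norm (W (-1) (x s)) + norm (W 1 (x s)))"
    if \<sigma>: "\<sigma> = 1 \<or> \<sigma> = -1" for s \<sigma>
  proof -
    have "norm (W \<sigma> (x s) + V \<sigma> (x s)) \<le> norm (W (-1) (x s)) + norm (W 1 (x s))"
      using norm_triangle_ineq[of "W \<sigma> (x s)" "V \<sigma> (x s)"] m_eq[OF \<sigma>, of "x s"] by (simp add: m_def)
    then have "norm c / 2 * norm (W \<sigma> (x s) + V \<sigma> (x s)) \<le> norm c / 2 * (norm (W (-1) (x s)) + norm (W 1 (x s)))"
      by (intro mult_left_mono) auto
    then show ?thesis using \<sigma> by (auto simp: err_def norm_mult norm_divide)
  qed
  have "norm c / 2 * L \<le> norm c / 2 * (1 / X0)" using L by (intro mult_left_mono) auto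
  also have "\<dots> \<le> 1 / 8" using X0 by (simp add: field_simps)
  finally have small: "norm c / 2 * L \<le> 1 / 8" .
  \<comment> \<open>On the real axis neither exponential decays, so the system is used with \<mu> =
    0. In the variable s the perturbation has the constant size norm c / 2, on an interval shorter
    than 1 / X0.\<close>
  have dWm: "((\<lambda>s. W (-1) (x s)) has_vector_derivative 0 * W (-1) (x s) + err (-1) s) (at s within {0..L})"
    if "s \<in> {0..L}" for s using dW[OF that, of "-1"] by simp
  have "norm (W (-1) (x L) - exp (0 * of_real L) * W (-1) (x 0)) \<le>
        2 * (norm c / 2) * L * (norm (W (-1) (x 0)) + norm (W 1 (x 0)))"
    and "norm (W 1 (x L) - W 1 (x 0)) \<le> 2 * (norm c / 2) * L * (norm (W (-1) (x 0)) + norm (W 1 (x 0)))"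
  proof -
    have "norm c / 2 * L \<le> 1 / 4" "0 \<le> norm c / 2" "L \<in> {0..L}" "Re 0 \<le> 0"
      using small L(1) by simp_all
    note * = perturbed_diagonal_system[where a = "\<lambda>s. W (-1) (x s)" and b = "\<lambda>s. W 1 (x s)" and
      ea = "err (-1)" and eb = "err 1" and \<epsilon> = "norm c / 2", OF L(1) dWm dW err err this(4,2,1,3)]
    show "norm (W (-1) (x L) - exp (0 * of_real L) * W (-1) (x 0)) \<le>
        2 * (norm c / 2) * L * (norm (W (-1) (x 0)) + norm (W 1 (x 0)))"
      by (rule *(1)) simp_all
    show "norm (W 1 (x L) - W 1 (x 0)) \<le> 2 * (norm c / 2) * L * (norm (W (-1) (x 0)) + norm (W 1 (x 0)))"
      by (rule *(2)) simp_all
  qed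
  moreover have "2 * (norm c / 2) * L * (norm (W (-1) (x 0)) + norm (W 1 (x 0))) \<le> 1 / 4 * m X0"
    using small by (intro mult_mono) (linarith | simp add: m_def ends add.commute)+
  ultimately have *: "norm (W (-1) X - W (-1) X0) \<le> m X0 / 4" "norm (W 1 X - W 1 X0) \<le> m X0 / 4"
    by (simp_all add: ends)
  show "m X0 / 2 \<le> m X" "m X \<le> 2 * m X0"
    using * norm_triangle_sub[of "W 1 X" "W 1 X0"] norm_triangle_sub[of "W (-1) X" "W (-1) X0"]
      norm_triangle_sub[of "W 1 X0" "W 1 X"] norm_triangle_sub[of "W (-1) X0" "W (-1) X"]
      m_pos[of X0] X0
    by (simp_all add: m_def norm_minus_commute)
qed

text \<open>The share 2 comes from the vertical segment of the path in \<open>asymptotics\<close>,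
  the share 3 from the horizontal one.\<close>

definition K :: real where "K = 5 * norm c * m X0"

lemma K_nonneg: "K \<ge> 0"
  by (simp add: K_def m_def)

lemma X0_props: "X0 \<ge> 1" "norm c \<le> X0 / 4"
  by (simp_all add: X0_def)

text \<open>A point of the boundary is reached from X on the real axis by a vertical segment and, if
  necessary, a horizontal one from the corner back towards the imaginary axis. Along the first exp(2
  i \<sigma> z) decays, along the second its modulus is constant.\<close>

lemma asymptotics:
  assumes \<sigma>: "\<sigma> = 1 \<or> \<sigma> = -1" and X: "X \<ge> X0"
    and z: "0 \<le> Re z" "Re z \<le> X" "0 \<le> \<sigma> * Im z" "\<sigma> * Im z \<le> X" "Re z = X \<or> \<sigma> * Im z = X"
  shows "norm (V \<sigma> z - exp (2 * \<i> * \<sigma> * z) * W (- \<sigma>) X) \<le> K / X"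
    and "norm (W \<sigma> z - W \<sigma> X) \<le> K / X"
proof -
  have Xpos: "X > 0" and cX: "norm c \<le> X / 4" using X X0_props by linarith+
  have V0: "V \<sigma> X = exp (2 * \<i> * \<sigma> * X) * W (- \<sigma>) X" by (simp add: V_eq_W)
  have \<sigma>2: "\<sigma> * (\<sigma> * t) = t" "complex_of_real \<sigma> * (complex_of_real \<sigma> * w) = w" for t w using \<sigma> by auto
  have side: "norm (V \<sigma> (X + \<i> * \<sigma> * L) - exp (2 * \<i> * \<sigma> * (X + \<i> * \<sigma> * L)) * W (- \<sigma>) X) \<le> 2 * norm c * m X0 / X"
       "norm (W \<sigma> (X + \<i> * \<sigma> * L) - W \<sigma> X) \<le> 2 * norm c * m X0 / X" if L: "0 \<le> L" "L \<le> X" for L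
  proof -
    have small: "norm c * L / X\<^sup>2 \<le> norm c / X"
      using L Xpos by (simp add: field_simps power2_eq_square mult_right_mono)
    have bd: "norm c * L / X\<^sup>2 * (norm (V \<sigma> X) + norm (W \<sigma> X)) \<le> norm c / X * (2 * m X0)"
      using small m_bounds(2)[OF X] m_eq[OF \<sigma>, of X] Xpos by (intro mult_mono) auto
    have e: "exp (2 * \<i> * \<sigma> * (X + \<i> * \<sigma> * L)) = exp (2 * \<i> * \<sigma> * (\<i> * \<sigma>) * L) * exp (2 * \<i> * \<sigma> * X)"
      by (simp add: algebra_simps flip: exp_add)
    have "norm (V \<sigma> (X + (\<i> * \<sigma>) * L) - exp (2 * \<i> * \<sigma> * (\<i> * \<sigma>) * L) * V \<sigma> X) \<le>
             norm c * L / X\<^sup>2 * (norm (V \<sigma> X) + norm (W \<sigma> X)) \<and>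
        norm (W \<sigma> (X + (\<i> * \<sigma>) * L) - W \<sigma> X) \<le> norm c * L / X\<^sup>2 * (norm (V \<sigma> X) + norm (W \<sigma> X))"
    proof (rule segment_bound[OF \<sigma>])
      show "norm c * L / (2 * X\<^sup>2) \<le> 1 / 4"
      proof -
        have "norm c / X \<le> 1 / 4" using cX Xpos by (simp add: field_simps)
        with small have "norm c * L / X\<^sup>2 \<le> 1 / 4" by linarith
        moreover have "norm c * L / (2 * X\<^sup>2) \<le> norm c * L / X\<^sup>2"
          using L Xpos by (intro divide_left_mono) auto
        ultimately show ?thesis by (rule order_trans[rotated])
      qed
      show "of_real X + \<i> * \<sigma> * of_real s \<notin> \<real>\<^sub>\<le>\<^sub>0 \<and> X \<le> norm (of_real X + \<i> * \<sigma> * of_real s)" if "s \<in> {0..L}" for s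
        using complex_Re_le_cmod[of "of_real X + \<i> * \<sigma> * of_real s"] Xpos by (auto simp: complex_nonpos_Reals_iff)
    qed (use \<sigma> L Xpos in \<open>auto simp: norm_mult\<close>)
    with bd show "norm (V \<sigma> (X + \<i> * \<sigma> * L) - exp (2 * \<i> * \<sigma> * (X + \<i> * \<sigma> * L)) * W (- \<sigma>) X) \<le> 2 * norm c * m X0 / X"
       "norm (W \<sigma> (X + \<i> * \<sigma> * L) - W \<sigma> X) \<le> 2 * norm c * m X0 / X"
      unfolding e V0 by (simp_all add: mult_ac)
  qed
  have mX0: "m X0 > 0" using m_pos X0_props by simp
  have "norm (V \<sigma> z - exp (2 * \<i> * \<sigma> * z) * W (- \<sigma>) X) \<le> K / X \<and> norm (W \<sigma> z - W \<sigma> X) \<le> K / X"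
  proof (cases "Re z = X")
    case True
    then have "z = X + \<i> * \<sigma> * (\<sigma> * Im z)" by (simp add: complex_eq_iff \<sigma>2)
    then have "norm (V \<sigma> z - exp (2 * \<i> * \<sigma> * z) * W (- \<sigma>) X) \<le> 2 * norm c * m X0 / X"
       "norm (W \<sigma> z - W \<sigma> X) \<le> 2 * norm c * m X0 / X"
      using side[OF z(3,4)] by simp_all
    moreover have "2 * norm c * m X0 / X \<le> K / X"
      unfolding K_def using Xpos mX0 by (intro divide_right_mono mult_right_mono) auto
    ultimately show ?thesis by linarith
  next
    case False
    then have Imz: "\<sigma> * Im z = X" using z by auto
    define L where "L = X - Re z"
    define k where "k = X + \<i> * \<sigma> * X"
    have L: "0 \<le> L" "L \<le> X" using z by (auto simp: L_def)
    have zk: "z = k + (-1) * of_real L"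
      using \<sigma> Imz by (auto simp: k_def L_def complex_eq_iff)
    have small: "norm c * L / X\<^sup>2 \<le> norm c / X"
      using L Xpos by (simp add: field_simps power2_eq_square mult_right_mono)
    have Vk: "norm (V \<sigma> k - exp (2 * \<i> * \<sigma> * k) * W (- \<sigma>) X) \<le> 2 * norm c * m X0 / X"
      and Wk: "norm (W \<sigma> k - W \<sigma> X) \<le> 2 * norm c * m X0 / X"
      using side[of X] Xpos by (simp_all add: k_def)
    have ek: "norm (exp (2 * \<i> * \<sigma> * k)) \<le> 1"
      using Xpos \<sigma> by (auto simp: k_def)
    have "norm (exp (2 * \<i> * \<sigma> * k) * W (- \<sigma>) X) \<le> norm (V \<sigma> X)"
      using mult_right_mono[OF ek, of "norm (W (- \<sigma>) X)"] by (simp add: norm_mult norm_V_real)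
    moreover have "norm c * m X0 / X \<le> m X0 / 4"
      using mX0 cX Xpos by (simp add: field_simps)
    moreover have two: "2 * norm c * m X0 / X = 2 * (norm c * m X0 / X)" by simp
    \<comment> \<open>The vertical segment changes each component by at most m X0 / 2, because norm
      c / X \<le> 1/4; this is added to m X \<le> 2 m X0.\<close>
    ultimately have mk: "norm (V \<sigma> k) + norm (W \<sigma> k) \<le> 3 * m X0"
      using Vk Wk norm_triangle_sub[of "V \<sigma> k" "exp (2 * \<i> * \<sigma> * k) * W (- \<sigma>) X"]
        norm_triangle_sub[of "W \<sigma> k" "W \<sigma> X"] m_eq[OF \<sigma>, of X] m_bounds(2)[OF X] two by linarith
    have bd: "norm c * L / X\<^sup>2 * (norm (V \<sigma> k) + norm (W \<sigma> k)) \<le> norm c / X * (3 * m X0)"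
      using small mk Xpos by (intro mult_mono) auto
    have e: "exp (2 * \<i> * \<sigma> * z) = exp (2 * \<i> * \<sigma> * (-1) * complex_of_real L) * exp (2 * \<i> * \<sigma> * k)"
      by (simp add: zk algebra_simps flip: exp_add)
    have "norm (V \<sigma> (k + (-1) * complex_of_real L) - exp (2 * \<i> * \<sigma> * (-1) * complex_of_real L) * V \<sigma> k) \<le>
             norm c * L / X\<^sup>2 * (norm (V \<sigma> k) + norm (W \<sigma> k)) \<and>
        norm (W \<sigma> (k + (-1) * complex_of_real L) - W \<sigma> k) \<le> norm c * L / X\<^sup>2 * (norm (V \<sigma> k) + norm (W \<sigma> k))"
    proof (rule segment_bound[OF \<sigma>])
      show "norm c * L / (2 * X\<^sup>2) \<le> 1 / 4"
      proof -
        have "norm c / X \<le> 1 / 4" using cX Xpos by (simp add: field_simps)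
        with small have "norm c * L / X\<^sup>2 \<le> 1 / 4" by linarith
        moreover have "norm c * L / (2 * X\<^sup>2) \<le> norm c * L / X\<^sup>2"
          using L Xpos by (intro divide_left_mono) auto
        ultimately show ?thesis by (rule order_trans[rotated])
      qed
      show "k + (-1) * of_real s \<notin> \<real>\<^sub>\<le>\<^sub>0 \<and> X \<le> norm (k + (-1) * of_real s)" if "s \<in> {0..L}" for s
        using abs_Im_le_cmod[of "k + (-1) * of_real s"] Xpos \<sigma> by (auto simp: complex_nonpos_Reals_iff k_def)
    qed (use \<sigma> L Xpos in \<open>auto simp: norm_mult\<close>)
    then have Vz: "norm (V \<sigma> z - exp (2 * \<i> * \<sigma> * (-1) * complex_of_real L) * V \<sigma> k) \<le> norm c / X * (3 * m X0)"
      and Wz: "norm (W \<sigma> z - W \<sigma> k) \<le> norm c / X * (3 * m X0)"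
      using bd zk by simp_all
    \<comment> \<open>The error made up to the corner is carried along the horizontal side by a
      factor of modulus 1.\<close>
    have "norm (exp (2 * \<i> * \<sigma> * (-1) * complex_of_real L) * (V \<sigma> k - exp (2 * \<i> * \<sigma> * k) * W (- \<sigma>) X)) \<le> 2 * norm c * m X0 / X"
      using Vk by (simp add: norm_mult norm_exp_eq_Re)
    from norm_triangle_mono[OF Vz this]
    have "norm (V \<sigma> z - exp (2 * \<i> * \<sigma> * z) * W (- \<sigma>) X) \<le> norm c / X * (3 * m X0) + 2 * norm c * m X0 / X"
      unfolding e by (simp add: algebra_simps)
    moreover have "norm (W \<sigma> z - W \<sigma> X) \<le> norm c / X * (3 * m X0) + 2 * norm c * m X0 / X"
      using norm_triangle_mono[OF Wz Wk] by simp
    moreover have "norm c / X * (3 * m X0) + 2 * norm c * m X0 / X = K / X"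
      by (simp add: K_def field_simps)
    ultimately show ?thesis by (simp only:)
  qed
  then show "norm (V \<sigma> z - exp (2 * \<i> * \<sigma> * z) * W (- \<sigma>) X) \<le> K / X" "norm (W \<sigma> z - W \<sigma> X) \<le> K / X"
    by simp_all
qed

text \<open>The common amplitude: by \<open>W_eq_D\<close>, both coefficients are D X times exp(i
  \<sigma> pi p / 2) up to O(1/X), so that u(X) is close to 2 D X cos(X - pi p / 2).\<close>

definition D :: "real \<Rightarrow> complex" where
  "D X = exp (- (\<i> * pi * p / 2)) * W 1 X"

text \<open>Reflection in the origin forces the two oscillating components to have comparable size.\<close>

lemma W_eq_D:
  assumes \<sigma>: "\<sigma> = 1 \<or> \<sigma> = -1"
  obtains C where "C \<ge> 0" "\<And>X. X \<ge> X0 \<Longrightarrow> norm (W \<sigma> X - exp (\<i> * \<sigma> * pi * p / 2) * D X) \<le> C / X"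
proof -
  define C1 where "C1 = 2 * K + 2 * m X0"
  \<comment> \<open>On the imaginary axis the recessive part has size exp(-2X), so the dominant
    coefficient can be read off from u alone.\<close>
  have axis: "norm (exp (- of_real X) * u (\<i> * \<sigma> * X) - W \<sigma> X) \<le> C1 / X"
    if X: "X \<ge> X0" and \<sigma>: "\<sigma> = 1 \<or> \<sigma> = -1" for X \<sigma>
  proof -
    have Xpos: "X > 0" using X X0_props by linarith
    have eq: "exp (- of_real X) * u (\<i> * \<sigma> * X) = W \<sigma> (\<i> * \<sigma> * X) + V \<sigma> (\<i> * \<sigma> * X)"
      using u_eq[of \<sigma> "\<i> * \<sigma> * X"] \<sigma> by auto
    have a: "norm (V \<sigma> (\<i> * \<sigma> * X) - exp (2 * \<i> * \<sigma> * (\<i> * \<sigma> * X)) * W (- \<sigma>) X) \<le> K / X"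
      "norm (W \<sigma> (\<i> * \<sigma> * X) - W \<sigma> X) \<le> K / X"
      using asymptotics[OF \<sigma> X, of "\<i> * \<sigma> * X"] Xpos \<sigma> by auto
    have "norm (exp (2 * \<i> * \<sigma> * (\<i> * \<sigma> * X))) = exp (- 2 * X)"
      using \<sigma> by (auto simp: norm_exp_eq_Re)
    also have "\<dots> \<le> 1 / X"
    proof -
      have "X \<le> exp (2 * X)" using exp_ge_add_one_self[of "2 * X"] Xpos by linarith
      then show ?thesis using Xpos by (simp add: exp_minus field_simps)
    qed
    finally have "norm (exp (2 * \<i> * \<sigma> * (\<i> * \<sigma> * X)) * W (- \<sigma>) X) \<le> 1 / X * (2 * m X0)"
      using m_eq[OF \<sigma>, of X] m_bounds(2)[OF X] Xpos norm_ge_zero[of "W \<sigma> X"] unfolding norm_mult norm_V_real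
      by (intro mult_mono) (linarith | simp)+
    with a have "norm (exp (- of_real X) * u (\<i> * \<sigma> * X) - W \<sigma> X) \<le> K / X + (K / X + 1 / X * (2 * m X0))"
      unfolding eq using norm_triangle_sub[of "V \<sigma> (\<i> * \<sigma> * X)" "exp (2 * \<i> * \<sigma> * (\<i> * \<sigma> * X)) * W (- \<sigma>) X"]
        norm_triangle_ineq[of "W \<sigma> (\<i> * \<sigma> * X) - W \<sigma> X" "V \<sigma> (\<i> * \<sigma> * X)"] by (simp add: algebra_simps)
    also have "\<dots> = C1 / X" by (simp add: C1_def add_divide_distrib)
    finally show ?thesis .
  qed
  have C1: "C1 \<ge> 0" using K_nonneg by (simp add: C1_def m_def)
  define e where "e = exp (\<i> * pi * p / 2)"
  have e: "e \<noteq> 0" by (simp add: e_def)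
  define C where "C = C1 * norm (inverse e) * norm (inverse e) + C1"
  show thesis
  proof (cases "\<sigma> = 1")
    case True
    show thesis
      by (rule that[of 0]) (simp_all add: True D_def exp_minus)
  next
    case False
    then have [simp]: "\<sigma> = -1" using \<sigma> by auto
    show thesis
    proof (rule that[of C])
      show "C \<ge> 0" using C1 by (simp add: C_def)
      fix X assume X: "X \<ge> X0"
      have Xpos: "X > 0" using X X0_props by linarith
      define U where "U = exp (- of_real X) * u (\<i> * X)"
      \<comment> \<open>\<open>reflect\<close> expresses the value at -iX through the one at iX.
        These values approximate \<open>W (-1) X\<close> and \<open>W 1 X\<close>, which links the
        two coefficients.\<close>
      have "exp (- of_real X) * u (- \<i> * X) = inverse e * inverse e * U"
        using reflect[OF Xpos] e by (simp add: U_def e_def exp_minus field_simps)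
      then have 1: "norm (inverse e * inverse e * U - W (-1) X) \<le> C1 / X"
        using axis[OF X, of "-1"] by simp
      have 2: "norm (U - W 1 X) \<le> C1 / X"
        using axis[OF X, of 1] by (simp add: U_def)
      have "exp (\<i> * \<sigma> * pi * p / 2) * D X = inverse e * inverse e * W 1 X"
        by (simp add: D_def e_def exp_minus)
      then have "W \<sigma> X - exp (\<i> * \<sigma> * pi * p / 2) * D X =
          inverse e * inverse e * (U - W 1 X) - (inverse e * inverse e * U - W (-1) X)"
        by (simp add: algebra_simps)
      also have "norm \<dots> \<le> norm (inverse e) * norm (inverse e) * (C1 / X) + C1 / X"
        using norm_triangle_ineq4[of "inverse e * inverse e * (U - W 1 X)" "inverse e * inverse e * U - W (-1) X"]
          1 mult_left_mono[OF 2, of "norm (inverse e) * norm (inverse e)"] by (simp add: norm_mult)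
      also have "\<dots> = C / X" by (simp add: C_def add_divide_distrib)
      finally show "norm (W \<sigma> X - exp (\<i> * \<sigma> * pi * p / 2) * D X) \<le> C / X" .
    qed
  qed
qed

text \<open>Up to O(1/X), exp(i \<sigma> z) u(z) is D X times e(\<sigma>) + exp(2 i \<sigma> z)
  e(-\<sigma>), which is a multiple of cos(z - pi p / 2). On the vertical sides the two terms have
  equal phase, on the horizontal ones the second is negligible. At a zero of u the derivative
  involves the difference of the two components instead of their sum and cannot be small.\<close>

lemma square_bounds:
  obtains \<delta> C X1 where "\<delta> > 0" "X1 > 0"
    "\<And>X N z. X \<ge> X1 \<Longrightarrow> X = pi * Re p / 2 + pi * real N \<Longrightarrow> Re z = X \<Longrightarrow> \<bar>Im z\<bar> \<le> X \<Longrightarrow>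
       norm (u z) \<ge> \<delta> \<and> norm (u1 z) \<le> C * norm (u z)"
    "\<And>z. \<bar>Im z\<bar> \<ge> X1 \<Longrightarrow> 0 \<le> Re z \<Longrightarrow> Re z \<le> \<bar>Im z\<bar> \<Longrightarrow>
       norm (u z) \<ge> \<delta> \<and> norm (u1 z) \<le> C * norm (u z)"
    "\<And>z. Re z \<ge> 0 \<Longrightarrow> max (Re z) \<bar>Im z\<bar> \<ge> X1 \<Longrightarrow> u z = 0 \<Longrightarrow> norm (u1 z) \<ge> \<delta>"
proof -
  obtain Ca where Ca: "Ca \<ge> 0" "\<And>X. X \<ge> X0 \<Longrightarrow> norm (W 1 X - exp (\<i> * (1::real) * pi * p / 2) * D X) \<le> Ca / X"
    using W_eq_D[of 1] by blast
  obtain Cb where Cb: "Cb \<ge> 0" "\<And>X. X \<ge> X0 \<Longrightarrow> norm (W (-1) X - exp (\<i> * (-1::real) * pi * p / 2) * D X) \<le> Cb / X"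
    using W_eq_D[of "-1"] by blast
  define C where "C = Ca + Cb"
  define e where "e = (\<lambda>\<sigma>::real. exp (\<i> * \<sigma> * pi * p / 2))"
  define E where "E = exp (pi * \<bar>Im p\<bar> / 2)"
  have E: "E \<ge> 1" by (simp add: E_def)
  have ne: "norm (e \<sigma>) \<le> E" "1 / E \<le> norm (e \<sigma>)" if "\<sigma> = 1 \<or> \<sigma> = -1" for \<sigma>
  proof -
    have "norm (e \<sigma>) = exp (- \<sigma> * (pi * Im p / 2))" by (simp add: e_def)
    moreover have "\<bar>\<sigma> * (pi * Im p / 2)\<bar> = pi * \<bar>Im p\<bar> / 2"
      using that by (auto simp: abs_mult)
    moreover have "1 / E = exp (- (pi * \<bar>Im p\<bar> / 2))" by (simp add: E_def exp_minus inverse_eq_divide)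
    ultimately have "norm (e \<sigma>) \<le> E \<and> 1 / E \<le> norm (e \<sigma>)"
      by (simp only: E_def exp_le_cancel_iff) linarith
    then show "norm (e \<sigma>) \<le> E" "1 / E \<le> norm (e \<sigma>)" by blast+
  qed
  have C: "norm (W \<sigma> X - e \<sigma> * D X) \<le> C / X" if \<sigma>: "\<sigma> = 1 \<or> \<sigma> = -1" and X: "X \<ge> X0" for \<sigma> X
  proof -
    have "X > 0" using X X0_props by linarith
    then have "Ca / X \<ge> 0" "Cb / X \<ge> 0" using Ca Cb by auto
    then show ?thesis
      using \<sigma> Ca(2)[OF X] Cb(2)[OF X] by (auto simp: C_def e_def add_divide_distrib)
  qed
  have C0: "C \<ge> 0" using Ca Cb by (simp add: C_def)
  define \<delta> where "\<delta> = m X0 / (8 * E)"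
  have mX0: "m X0 > 0" using m_pos X0_props by simp
  have \<delta>: "\<delta> > 0" using mX0 E by (simp add: \<delta>_def)
  define K2 where "K2 = 2 * K + 2 * C"
  have K2: "K2 \<ge> 0" using K_nonneg C0 by (simp add: K2_def)
  define C3 where "C3 = 2 * m X0 + 2 * K"
  \<comment> \<open>The three summands after X0 ensure, in turn, C / X \<le> m X0 / 8 for the bound
    on D, K2 / X \<le> \<delta> / (4 E) for the approximation error, and E / X \<le> 1 / (2 E) on
    the horizontal sides.\<close>
  define X1 where "X1 = X0 + 8 * C / m X0 + 4 * E * K2 / \<delta> + 2 * E * E"
  have X1: "X1 \<ge> X0" "X1 \<ge> 8 * C / m X0" "X1 \<ge> 4 * E * K2 / \<delta>" "X1 \<ge> 2 * E * E"
    using X0_props C0 mX0 E K2 \<delta> by (simp_all add: X1_def add_nonneg_nonneg)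
  \<comment> \<open>Both coefficients are nearly multiples of D X with factors of modulus at most E,
    and together they have size at least m X0 / 2. So D X cannot be small.\<close>
  have D: "norm (D X) \<ge> \<delta>" if X: "X \<ge> X1" for X
  proof -
    have X': "X \<ge> X0" "X > 0" "X \<ge> 8 * C / m X0" using X X1 X0_props by linarith+
    have "norm (W \<sigma> X) \<le> E * norm (D X) + C / X" if "\<sigma> = 1 \<or> \<sigma> = -1" for \<sigma>
      using C[OF that X'(1)] ne(1)[OF that] norm_triangle_sub[of "W \<sigma> X" "e \<sigma> * D X"]
        mult_right_mono[OF ne(1)[OF that], of "norm (D X)"] by (simp add: norm_mult)
    from this[of 1] this[of "-1"] have "m X \<le> 2 * (E * norm (D X)) + 2 * (C / X)"
      by (simp add: m_def)
    moreover have "C / X \<le> m X0 / 8" using X' mX0 by (simp add: field_simps)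
    ultimately have "m X0 / 8 \<le> E * norm (D X)"
      using m_bounds(1)[OF X'(1)] by linarith
    then show ?thesis using E by (simp add: \<delta>_def field_simps)
  qed
  have approx: "norm (exp (\<i> * \<sigma> * z) * u z - D X * (e \<sigma> + exp (2 * \<i> * \<sigma> * z) * e (- \<sigma>))) \<le> K2 / X"
    "norm (W \<sigma> z - D X * e \<sigma>) \<le> K2 / X" "norm (exp (\<i> * \<sigma> * z) * u1 z) \<le> C3"
    "norm (exp (\<i> * \<sigma> * z)) \<le> 1"
    if \<sigma>: "\<sigma> = 1 \<or> \<sigma> = -1" and X: "X \<ge> X1"
    and z: "0 \<le> Re z" "Re z \<le> X" "0 \<le> \<sigma> * Im z" "\<sigma> * Im z \<le> X" "Re z = X \<or> \<sigma> * Im z = X" for \<sigma> X z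
  proof -
    have \<sigma>': "- \<sigma> = 1 \<or> - \<sigma> = -1" using \<sigma> by auto
    have X': "X \<ge> X0" "X \<ge> 1" using X X1 X0_props by linarith+
    note a = asymptotics[OF \<sigma> X'(1) z]
    have e1: "norm (exp (2 * \<i> * \<sigma> * z)) \<le> 1" using z by auto
    have "norm (exp (2 * \<i> * \<sigma> * z) * (W (- \<sigma>) X - e (- \<sigma>) * D X)) \<le> 1 * (C / X)"
      unfolding norm_mult using e1 C[OF \<sigma>' X'(1)] by (intro mult_mono) auto
    from norm_triangle_mono[OF a(1) this]
    have "norm (V \<sigma> z - exp (2 * \<i> * \<sigma> * z) * (e (- \<sigma>) * D X)) \<le> K / X + C / X"
      by (simp add: algebra_simps)
    moreover have W: "norm (W \<sigma> z - e \<sigma> * D X) \<le> K / X + C / X"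
      using norm_triangle_mono[OF a(2) C[OF \<sigma> X'(1)]] by simp
    ultimately have "norm ((W \<sigma> z - e \<sigma> * D X) + (V \<sigma> z - exp (2 * \<i> * \<sigma> * z) * (e (- \<sigma>) * D X)))
       \<le> (K / X + C / X) + (K / X + C / X)" by (intro norm_triangle_mono)
    then show "norm (exp (\<i> * \<sigma> * z) * u z - D X * (e \<sigma> + exp (2 * \<i> * \<sigma> * z) * e (- \<sigma>))) \<le> K2 / X"
      unfolding u_eq by (simp add: K2_def algebra_simps add_divide_distrib)
    have "K / X + C / X \<le> K2 / X" using K_nonneg C0 X' by (simp add: K2_def field_simps)
    with W show "norm (W \<sigma> z - D X * e \<sigma>) \<le> K2 / X" by (simp add: mult_ac)
    have KX: "K / X \<le> K" using divide_left_mono[of 1 X K] K_nonneg X' by simp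
    have "norm (exp (2 * \<i> * \<sigma> * z) * W (- \<sigma>) X) \<le> norm (V \<sigma> X)"
      using mult_right_mono[OF e1, of "norm (W (- \<sigma>) X)"] by (simp add: norm_mult norm_V_real)
    then have "norm (V \<sigma> z) + norm (W \<sigma> z) \<le> C3"
      using a KX norm_triangle_sub[of "V \<sigma> z" "exp (2 * \<i> * \<sigma> * z) * W (- \<sigma>) X"]
        norm_triangle_sub[of "W \<sigma> z" "W \<sigma> X"] m_eq[OF \<sigma>, of X] m_bounds(2)[OF X'(1)] by (simp add: C3_def)
    moreover have "norm (exp (\<i> * \<sigma> * z) * u1 z) = norm (exp (\<i> * \<sigma> * z) * (\<i> * \<sigma> * u1 z))"
      using \<sigma> by (auto simp: norm_mult)
    ultimately show "norm (exp (\<i> * \<sigma> * z) * u1 z) \<le> C3"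
      unfolding u1_eq using norm_triangle_ineq4[of "W \<sigma> z" "V \<sigma> z"] by linarith
    show "norm (exp (\<i> * \<sigma> * z)) \<le> 1" using z by simp
  qed
  have small: "K2 / X \<le> \<delta> / (4 * E)" if "X \<ge> X1" for X
  proof -
    have "X \<ge> 4 * E * K2 / \<delta>" "X > 0" using that X1 X0_props by linarith+
    then show ?thesis using \<delta> E by (simp add: field_simps)
  qed
  \<comment> \<open>This reduces the bounds on the sides to keeping the sum of the two exponentials
    away from 0.\<close>
  have main: "norm (u z) \<ge> \<delta> / (4 * E) \<and> norm (u1 z) \<le> C3 / (\<delta> / (4 * E)) * norm (u z)"
    if \<sigma>: "\<sigma> = 1 \<or> \<sigma> = -1" and X: "X \<ge> X1"
    and z: "0 \<le> Re z" "Re z \<le> X" "0 \<le> \<sigma> * Im z" "\<sigma> * Im z \<le> X" "Re z = X \<or> \<sigma> * Im z = X"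
    and lower: "norm (e \<sigma> + exp (2 * \<i> * \<sigma> * z) * e (- \<sigma>)) \<ge> 1 / (2 * E)" for \<sigma> X z
  proof -
    note a = approx[OF \<sigma> X z]
    have "\<delta> * (1 / (2 * E)) \<le> norm (D X * (e \<sigma> + exp (2 * \<i> * \<sigma> * z) * e (- \<sigma>)))"
      unfolding norm_mult using D[OF X] lower \<delta> E by (intro mult_mono) auto
    moreover have "\<delta> * (1 / (2 * E)) = 2 * (\<delta> / (4 * E))" by simp
    ultimately have low: "\<delta> / (4 * E) \<le> norm (exp (\<i> * \<sigma> * z) * u z)"
      using a(1) small[OF X] norm_triangle_sub[of "D X * (e \<sigma> + exp (2 * \<i> * \<sigma> * z) * e (- \<sigma>))" "exp (\<i> * \<sigma> * z) * u z"]
      unfolding norm_minus_commute[of "exp (\<i> * \<sigma> * z) * u z"] by linarith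
    have "norm (exp (\<i> * \<sigma> * z) * u z) \<le> norm (u z)"
      unfolding norm_mult using a(4) by (intro mult_left_le_one_le) auto
    with low have "norm (u z) \<ge> \<delta> / (4 * E)" by linarith
    moreover have "norm (u1 z) \<le> C3 / (\<delta> / (4 * E)) * norm (u z)"
    proof -
      have "norm (exp (\<i> * \<sigma> * z) * u1 z) \<le> C3 / (\<delta> / (4 * E)) * norm (exp (\<i> * \<sigma> * z) * u z)"
      proof -
        have "C3 \<ge> 0" using a(3) norm_ge_zero[of "exp (\<i> * \<sigma> * z) * u1 z"] by linarith
        then have "C3 * (\<delta> / (4 * E)) \<le> C3 * norm (exp (\<i> * \<sigma> * z) * u z)" using low by (intro mult_left_mono) auto
        then have "C3 \<le> C3 / (\<delta> / (4 * E)) * norm (exp (\<i> * \<sigma> * z) * u z)"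
          using \<delta> E by (simp add: field_simps)
        with a(3) show ?thesis by linarith
      qed
      then have "norm (exp (\<i> * \<sigma> * z)) * norm (u1 z) \<le> norm (exp (\<i> * \<sigma> * z)) * (C3 / (\<delta> / (4 * E)) * norm (u z))"
        unfolding norm_mult by (simp only: mult_ac)
      then show ?thesis by (rule mult_left_le_imp_le) simp
    qed
    ultimately show ?thesis ..
  qed
  show thesis
  proof (rule that[of "\<delta> / (4 * E)" X1 "C3 / (\<delta> / (4 * E))"])
    show "\<delta> / (4 * E) > 0" "X1 > 0" using \<delta> E X1 X0_props by simp_all
  next
    fix X N z
    assume X: "X \<ge> X1" "X = pi * Re p / 2 + pi * real N" and z: "Re z = X" "\<bar>Im z\<bar> \<le> X"
    define \<sigma> :: real where "\<sigma> = (if Im z \<ge> 0 then 1 else -1)"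
    have \<sigma>: "\<sigma> = 1 \<or> \<sigma> = -1" "\<sigma> * Im z = \<bar>Im z\<bar>" by (auto simp: \<sigma>_def)
    \<comment> \<open>e(\<sigma>) has phase w and modulus r. The choice of X turns exp(2 i \<sigma>
      z) into w^2 exp(-2 |Im z|), so the second summand also has phase w and the moduli add
      up.\<close>
    define r where "r = exp (- \<sigma> * pi * Im p / 2)"
    define w where "w = exp (\<i> * (\<sigma> * pi * Re p / 2))"
    have w: "norm w = 1" by (simp add: w_def)
    have e1: "e \<sigma> = w * r" "e (- \<sigma>) = inverse w * inverse r"
      unfolding e_def w_def r_def of_real_exp exp_add[symmetric] exp_minus[symmetric] of_real_inverse[symmetric]
      by (rule arg_cong[where f = exp], simp add: complex_eq_iff)+
    define B where "B = \<i> * (\<sigma> * pi * Re p / 2)"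
    have eq: "2 * \<i> * \<sigma> * z = of_nat N * (2 * pi * \<i> * \<sigma>) + (B + B) + complex_of_real (- 2 * \<bar>Im z\<bar>)"
      using X z \<sigma>(2) by (simp add: complex_eq_iff algebra_simps B_def)
    have "exp (2 * \<i> * \<sigma> * z) = exp (of_nat N * (2 * pi * \<i> * \<sigma>)) * (w * w) * exp (- 2 * \<bar>Im z\<bar>)"
      unfolding eq w_def B_def[symmetric] by (simp only: exp_add exp_of_real)
    moreover have "exp (of_nat N * (2 * pi * \<i> * \<sigma>)) = 1"
      unfolding exp_of_nat_mult using \<sigma>(1) by (elim disjE) (simp_all add: exp_minus)
    ultimately have "e \<sigma> + exp (2 * \<i> * \<sigma> * z) * e (- \<sigma>) = w * complex_of_real (r + exp (- 2 * \<bar>Im z\<bar>) * inverse r)"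
      using w by (simp add: e1 field_simps)
    moreover have "r > 0" by (simp add: r_def)
    ultimately have "norm (e \<sigma> + exp (2 * \<i> * \<sigma> * z) * e (- \<sigma>)) = r + exp (- 2 * \<bar>Im z\<bar>) * inverse r"
      using w by (simp add: norm_mult del: of_real_add)
    also have "\<dots> \<ge> r" using \<open>r > 0\<close> by simp
    also have "r = norm (e \<sigma>)" using e1 w \<open>r > 0\<close> by (simp add: norm_mult)
    also have "norm (e \<sigma>) \<ge> 1 / E" by (rule ne(2)[OF \<sigma>(1)])
    also have "1 / E \<ge> 1 / (2 * E)" using E by (simp add: field_simps)
    finally have "norm (e \<sigma> + exp (2 * \<i> * \<sigma> * z) * e (- \<sigma>)) \<ge> 1 / (2 * E)" .
    then show "norm (u z) \<ge> \<delta> / (4 * E) \<and> norm (u1 z) \<le> C3 / (\<delta> / (4 * E)) * norm (u z)"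
      using X z \<sigma> X1 X0_props by (intro main[OF \<sigma>(1) X(1)]) auto
  next
    fix z assume z: "\<bar>Im z\<bar> \<ge> X1" "0 \<le> Re z" "Re z \<le> \<bar>Im z\<bar>"
    define \<sigma> :: real where "\<sigma> = (if Im z \<ge> 0 then 1 else -1)"
    have \<sigma>: "\<sigma> = 1 \<or> \<sigma> = -1" "\<sigma> * Im z = \<bar>Im z\<bar>" by (auto simp: \<sigma>_def)
    have \<sigma>': "- \<sigma> = 1 \<or> - \<sigma> = -1" using \<sigma> by auto
    define X where "X = \<bar>Im z\<bar>"
    have X: "X \<ge> X1" "X > 0" "X \<ge> 2 * E * E" using z X1 X0_props unfolding X_def by linarith+
    have "norm (exp (2 * \<i> * \<sigma> * z)) = exp (- 2 * X)" using \<sigma>(2) by (simp add: X_def)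
    also have "\<dots> \<le> 1 / X"
    proof -
      have "X \<le> exp (2 * X)" using exp_ge_add_one_self[of "2 * X"] X by linarith
      then show ?thesis using X by (simp add: exp_minus field_simps)
    qed
    finally have "norm (exp (2 * \<i> * \<sigma> * z) * e (- \<sigma>)) \<le> 1 / X * E"
      unfolding norm_mult using ne(1)[OF \<sigma>'] X by (intro mult_mono) auto
    also have "\<dots> \<le> 1 / (2 * E)" using X E by (simp add: field_simps)
    finally have "norm (e \<sigma> + exp (2 * \<i> * \<sigma> * z) * e (- \<sigma>)) \<ge> 1 / E - 1 / (2 * E)"
      using ne(2)[OF \<sigma>(1)] norm_diff_ineq[of "e \<sigma>" "exp (2 * \<i> * \<sigma> * z) * e (- \<sigma>)"] by linarith
    then have "norm (e \<sigma> + exp (2 * \<i> * \<sigma> * z) * e (- \<sigma>)) \<ge> 1 / (2 * E)" by (simp add: field_simps)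
    then show "norm (u z) \<ge> \<delta> / (4 * E) \<and> norm (u1 z) \<le> C3 / (\<delta> / (4 * E)) * norm (u z)"
      using X z \<sigma> by (intro main[OF \<sigma>(1) X(1)]) (auto simp: X_def)
  next
    fix z assume z: "Re z \<ge> 0" "max (Re z) \<bar>Im z\<bar> \<ge> X1" "u z = 0"
    define \<sigma> :: real where "\<sigma> = (if Im z \<ge> 0 then 1 else -1)"
    have \<sigma>: "\<sigma> = 1 \<or> \<sigma> = -1" "\<sigma> * Im z = \<bar>Im z\<bar>" by (auto simp: \<sigma>_def)
    define X where "X = max (Re z) \<bar>Im z\<bar>"
    have X: "X \<ge> X1" using z by (simp add: X_def)
    have z': "Re z \<le> X" "0 \<le> \<sigma> * Im z" "\<sigma> * Im z \<le> X" "Re z = X \<or> \<sigma> * Im z = X"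
      unfolding \<sigma>(2) X_def by linarith+
    note a = approx(2,4)[OF \<sigma>(1) X z(1) z']
    have n1: "norm (exp (\<i> * \<sigma> * z)) \<le> 1" by (fact a(2))
    note a(1)
    moreover have "\<delta> * (1 / E) \<le> norm (D X * e \<sigma>)"
      unfolding norm_mult using D[OF X] ne(2)[OF \<sigma>(1)] \<delta> E by (intro mult_mono) auto
    moreover have "\<delta> * (1 / E) = 4 * (\<delta> / (4 * E))" by simp
    moreover have "\<delta> / (4 * E) > 0" using \<delta> E by simp
    ultimately have "norm (W \<sigma> z) \<ge> \<delta> / (4 * E)"
      using small[OF X] norm_triangle_sub[of "D X * e \<sigma>" "W \<sigma> z"] unfolding norm_minus_commute[of "W \<sigma> z"] by linarith
    \<comment> \<open>As u = 0 forces the components to be opposite, the derivative is twice the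
      dominant one, which is close to D X e(\<sigma>).\<close>
    moreover have "V \<sigma> z = - W \<sigma> z"
      using u_eq[of \<sigma> z] z by (simp add: eq_neg_iff_add_eq_0 add.commute)
    then have "exp (\<i> * \<sigma> * z) * (\<i> * \<sigma> * u1 z) = 2 * W \<sigma> z"
      using u1_eq[of \<sigma> z] by simp
    then have "norm (exp (\<i> * \<sigma> * z) * (\<i> * \<sigma> * u1 z)) = norm (2 * W \<sigma> z)" by (rule arg_cong)
    then have "norm (exp (\<i> * \<sigma> * z)) * norm (u1 z) = 2 * norm (W \<sigma> z)"
      using \<sigma>(1) by (auto simp only: norm_mult) simp_all
    moreover have "norm (exp (\<i> * \<sigma> * z)) * norm (u1 z) \<le> norm (u1 z)"
      using n1 by (intro mult_left_le_one_le) auto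
    ultimately show "norm (u1 z) \<ge> \<delta> / (4 * E)"
      using norm_ge_zero[of "W \<sigma> z"] by linarith
  qed
qed

end

subsection \<open>Bounds on squares and residues\<close>

text \<open>The factor z^p with 2p = 2 \<nu> + 1 cancels the first-order term of the Bessel equation
  and leaves the constant c = -p (p - 1) = 1/4 - \<nu>^2. \<open>reflect\<close> is the evenness of
  \<open>dunkl_I\<close>; \<open>nontriv\<close> holds because its zeros are simple.\<close>

lemma dunkl_normal_form:
  assumes "\<nu> + 1 \<notin> \<int>\<^sub>\<le>\<^sub>0"
  defines "p \<equiv> \<nu> + 1 / 2"
  shows "bessel_normal_form (\<lambda>z. z powr p * dunkl_I \<nu> (\<i> * z))
    (\<lambda>z. z powr p * (\<i> * deriv (dunkl_I \<nu>) (\<i> * z) + p * dunkl_I \<nu> (\<i> * z) / z)) (- p * (p - 1)) p"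
proof
  have I: "((\<lambda>z. dunkl_I \<nu> (\<i> * z)) has_field_derivative \<i> * deriv (dunkl_I \<nu>) (\<i> * z)) (at z)" for z
    by (rule DERIV_chain2[where f = "dunkl_I \<nu>" and Db = \<i>, THEN DERIV_cong])
      (use DERIV_dunkl_I[OF assms(1), THEN DERIV_deriv_iff_has_field_derivative[THEN iffD2, OF exI]] in \<open>auto intro!: derivative_eq_intros\<close>)
  have I1: "((\<lambda>z. deriv (dunkl_I \<nu>) (\<i> * z)) has_field_derivative
      \<i> * (dunkl_I \<nu> (\<i> * z) - (2 * \<nu> + 1) / (\<i> * z) * deriv (dunkl_I \<nu>) (\<i> * z))) (at z)" if "z \<noteq> 0" for z
    by (rule DERIV_chain2[where f = "deriv (dunkl_I \<nu>)" and Db = \<i>, THEN DERIV_cong])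
      (use DERIV_deriv_dunkl_I[OF assms(1), of "\<i> * z"] that in \<open>auto intro!: derivative_eq_intros\<close>)
  have P: "((\<lambda>z. z powr p) has_field_derivative p / z * z powr p) (at z)" if "z \<notin> \<real>\<^sub>\<le>\<^sub>0" for z
    using has_field_derivative_powr[OF that, of p] that by (auto simp: powr_diff)
  fix z :: complex assume z: "z \<notin> \<real>\<^sub>\<le>\<^sub>0"
  then have z0: "z \<noteq> 0" by auto
  show "((\<lambda>z. z powr p * dunkl_I \<nu> (\<i> * z)) has_field_derivative
      z powr p * (\<i> * deriv (dunkl_I \<nu>) (\<i> * z) + p * dunkl_I \<nu> (\<i> * z) / z)) (at z)"
    by (rule DERIV_cong[OF DERIV_mult[OF P[OF z] I]]) (simp add: algebra_simps)
  have \<nu>: "2 * \<nu> + 1 = 2 * p" by (simp add: p_def)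
  note d = DERIV_mult[OF P[OF z] DERIV_add[OF DERIV_cmult[OF I1[OF z0, unfolded \<nu>], of \<i>]
    DERIV_divide[OF DERIV_cmult[OF I, of p] DERIV_ident z0]]]
  show "((\<lambda>z. z powr p * (\<i> * deriv (dunkl_I \<nu>) (\<i> * z) + p * dunkl_I \<nu> (\<i> * z) / z)) has_field_derivative
     - (1 + - p * (p - 1) / z\<^sup>2) * (z powr p * dunkl_I \<nu> (\<i> * z))) (at z)"
    by (rule DERIV_cong[OF d]) (use z0 in \<open>simp add: field_simps power2_eq_square\<close>)
next
  fix x :: real assume x: "x > 0"
  have "(\<i> * complex_of_real x) powr p = exp (\<i> * pi * p / 2) * exp (p * ln x)"
    using x by (simp add: powr_def Ln_times_ii Ln_of_real algebra_simps exp_add)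
  moreover have "(- \<i> * complex_of_real x) powr p = exp (- (\<i> * pi * p / 2)) * exp (p * ln x)"
  proof -
    have Ln: "Ln (- \<i> * complex_of_real x) = ln x - \<i> * pi / 2"
      using x Ln_times_of_real[of x "- \<i>"] Ln_of_real[of x] by (simp add: mult.commute)
    show ?thesis using x unfolding powr_def Ln by (simp add: algebra_simps flip: exp_add)
  qed
  ultimately show "exp (- (\<i> * pi * p / 2)) * ((\<i> * of_real x) powr p * dunkl_I \<nu> (\<i> * (\<i> * of_real x))) =
      exp (\<i> * pi * p / 2) * ((- \<i> * of_real x) powr p * dunkl_I \<nu> (\<i> * (- \<i> * of_real x)))"
    using dunkl_I_minus[of \<nu> "of_real x"] by (simp add: exp_minus)
next
  fix x :: real assume x: "x > 0"
  show "complex_of_real x powr p * dunkl_I \<nu> (\<i> * of_real x) \<noteq> 0 \<or>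
     of_real x powr p * (\<i> * deriv (dunkl_I \<nu>) (\<i> * of_real x) + p * dunkl_I \<nu> (\<i> * of_real x) / of_real x) \<noteq> 0"
    using dunkl_I_zero_simple[OF assms(1), of "\<i> * of_real x"] x by auto
qed

text \<open>For complex p the modulus of z^p carries the extra factor exp(- Im p Arg z), and |Arg z|
  \<le> pi.\<close>

lemma norm_powr_bounds:
  fixes z p :: complex
  assumes "z \<noteq> 0"
  defines "M \<equiv> exp (pi * \<bar>Im p\<bar>)"
  shows "norm (z powr p) \<le> M * norm z powr Re p" "norm z powr Re p \<le> M * norm (z powr p)"
proof -
  have "\<bar>Im p * Arg z\<bar> \<le> pi * \<bar>Im p\<bar>"
    using mpi_less_Arg[of z] Arg_le_pi[of z] by (simp add: abs_mult mult.commute abs_le_iff mult_right_mono)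
  then have "exp (- Im p * Arg z) \<le> M" "1 \<le> M * exp (- Im p * Arg z)"
    by (simp_all add: M_def flip: exp_add)
  then show "norm (z powr p) \<le> M * norm z powr Re p" "norm z powr Re p \<le> M * norm (z powr p)"
    using mult_left_mono[of "exp (- Im p * Arg z)" M "norm z powr Re p"]
      mult_left_mono[of 1 "M * exp (- Im p * Arg z)" "norm z powr Re p"]
    by (simp_all add: norm_powr_complex mult_ac)
qed

lemma deriv_dunkl_I_minus:
  assumes "\<nu> + 1 \<notin> \<int>\<^sub>\<le>\<^sub>0"
  shows "deriv (dunkl_I \<nu>) (- t) = - deriv (dunkl_I \<nu>) t"
  unfolding DERIV_imp_deriv[OF DERIV_dunkl_I[OF assms]] by (simp add: dunkl_I_minus)

text \<open>The bounds for u, divided by z^p and rotated by t = iz. The second conclusion confines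
  the zeros with large real part to the sector |Re t| < |Im t| around the imaginary axis.\<close>

lemma dunkl_I_square_bounds:
  assumes \<nu>: "\<nu> + 1 \<notin> \<int>\<^sub>\<le>\<^sub>0"
  obtains \<delta> C X1 where "\<delta> > 0" "X1 > 0"
    "\<And>X N t. X \<ge> X1 \<Longrightarrow> X = pi * (Re \<nu> + 1 / 2) / 2 + pi * real N \<Longrightarrow> max \<bar>Re t\<bar> \<bar>Im t\<bar> = X \<Longrightarrow>
       norm (dunkl_I \<nu> t) \<ge> \<delta> * norm t powr - (Re \<nu> + 1 / 2) \<and>
       norm (deriv (dunkl_I \<nu>) t) \<le> C * norm (dunkl_I \<nu> t)"
    "\<And>t. X1 \<le> \<bar>Re t\<bar> \<Longrightarrow> \<bar>Im t\<bar> \<le> \<bar>Re t\<bar> \<Longrightarrow> dunkl_I \<nu> t \<noteq> 0"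
    "\<And>t. max \<bar>Re t\<bar> \<bar>Im t\<bar> \<ge> X1 \<Longrightarrow> dunkl_I \<nu> t = 0 \<Longrightarrow>
       norm (deriv (dunkl_I \<nu>) t) \<ge> \<delta> * norm t powr - (Re \<nu> + 1 / 2)"
proof -
  define p where "p = \<nu> + 1 / 2"
  define u where "u = (\<lambda>z. z powr p * dunkl_I \<nu> (\<i> * z))"
  define u1 where "u1 = (\<lambda>z. z powr p * (\<i> * deriv (dunkl_I \<nu>) (\<i> * z) + p * dunkl_I \<nu> (\<i> * z) / z))"
  interpret bessel_normal_form u u1 "- p * (p - 1)" p
    unfolding u_def u1_def p_def by (rule dunkl_normal_form[OF \<nu>])
  obtain \<delta> C X1 where \<delta>: "\<delta> > 0" and X1: "X1 > 0" and
    right: "\<And>X N z. X \<ge> X1 \<Longrightarrow> X = pi * Re p / 2 + pi * real N \<Longrightarrow> Re z = X \<Longrightarrow> \<bar>Im z\<bar> \<le> X \<Longrightarrow>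
       norm (u z) \<ge> \<delta> \<and> norm (u1 z) \<le> C * norm (u z)" and
    top: "\<And>z. \<bar>Im z\<bar> \<ge> X1 \<Longrightarrow> 0 \<le> Re z \<Longrightarrow> Re z \<le> \<bar>Im z\<bar> \<Longrightarrow>
       norm (u z) \<ge> \<delta> \<and> norm (u1 z) \<le> C * norm (u z)" and
    zero: "\<And>z. Re z \<ge> 0 \<Longrightarrow> max (Re z) \<bar>Im z\<bar> \<ge> X1 \<Longrightarrow> u z = 0 \<Longrightarrow> norm (u1 z) \<ge> \<delta>"
    by (rule square_bounds) blast
  define M where "M = exp (pi * \<bar>Im p\<bar>)"
  have M: "M > 0" by (simp add: M_def)
  have Rep: "Re p = Re \<nu> + 1 / 2" by (simp add: p_def)
  have lower: "\<delta> / M * norm z powr - Re p \<le> norm w" if "z \<noteq> 0" "\<delta> \<le> norm (z powr p * w)" for z w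
  proof -
    have "\<delta> \<le> norm (z powr p) * norm w" using that by (simp add: norm_mult)
    also have "\<dots> \<le> M * norm z powr Re p * norm w"
      using norm_powr_bounds(1)[OF that(1), of p] by (intro mult_right_mono) (auto simp: M_def)
    finally show ?thesis
      using M that(1) by (simp add: powr_minus field_simps)
  qed
  \<comment> \<open>\<open>u1\<close> contains p u / z besides the wanted derivative; for norm z
    \<ge> 1 this term costs at most norm p. The maximum in \<open>X2\<close> secures norm z \<ge>
    1.\<close>
  define C' where "C' = C + norm p"
  have ratio: "norm (deriv (dunkl_I \<nu>) (\<i> * z)) \<le> C' * norm (dunkl_I \<nu> (\<i> * z))"
    if "norm z \<ge> 1" "norm (u1 z) \<le> C * norm (u z)" for z
  proof -
    have z0: "z \<noteq> 0" using that by auto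
    then have "norm (z powr p) > 0" by simp
    moreover have "norm (z powr p) * norm (\<i> * deriv (dunkl_I \<nu>) (\<i> * z) + p * dunkl_I \<nu> (\<i> * z) / z)
       \<le> norm (z powr p) * (C * norm (dunkl_I \<nu> (\<i> * z)))"
      using that(2) by (simp add: u_def u1_def norm_mult mult_ac)
    ultimately have "norm (\<i> * deriv (dunkl_I \<nu>) (\<i> * z) + p * dunkl_I \<nu> (\<i> * z) / z) \<le> C * norm (dunkl_I \<nu> (\<i> * z))"
      by (simp only: mult_le_cancel_left_pos)
    moreover have "norm (p * dunkl_I \<nu> (\<i> * z) / z) \<le> norm p * norm (dunkl_I \<nu> (\<i> * z))"
    proof -
      have "norm (p * dunkl_I \<nu> (\<i> * z) / z) = norm p * norm (dunkl_I \<nu> (\<i> * z)) / norm z"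
        by (simp add: norm_mult norm_divide)
      also have "\<dots> \<le> norm p * norm (dunkl_I \<nu> (\<i> * z)) / 1"
        using that(1) by (intro divide_left_mono) auto
      finally show ?thesis by simp
    qed
    ultimately have "norm (\<i> * deriv (dunkl_I \<nu>) (\<i> * z)) \<le> C * norm (dunkl_I \<nu> (\<i> * z)) + norm p * norm (dunkl_I \<nu> (\<i> * z))"
      using norm_triangle_ineq4[of "\<i> * deriv (dunkl_I \<nu>) (\<i> * z) + p * dunkl_I \<nu> (\<i> * z) / z" "p * dunkl_I \<nu> (\<i> * z) / z"]
      by (simp only: add_diff_cancel_right')
    then show ?thesis by (simp add: C'_def norm_mult algebra_simps)
  qed
  define X2 where "X2 = max X1 1"
  have "(max \<bar>Re t\<bar> \<bar>Im t\<bar> = X \<longrightarrow> X \<ge> X2 \<longrightarrow> X = pi * Re p / 2 + pi * real N \<longrightarrow>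
        norm (dunkl_I \<nu> t) \<ge> \<delta> / M * norm t powr - Re p \<and>
        norm (deriv (dunkl_I \<nu>) t) \<le> C' * norm (dunkl_I \<nu> t)) \<and>
     (X2 \<le> \<bar>Re t\<bar> \<longrightarrow> \<bar>Im t\<bar> \<le> \<bar>Re t\<bar> \<longrightarrow> dunkl_I \<nu> t \<noteq> 0) \<and>
     (max \<bar>Re t\<bar> \<bar>Im t\<bar> \<ge> X2 \<longrightarrow> dunkl_I \<nu> t = 0 \<longrightarrow>
       norm (deriv (dunkl_I \<nu>) t) \<ge> \<delta> / M * norm t powr - Re p)" (is "?P X N t")
    if t: "Im t \<ge> 0" for t X N
  proof (intro conjI impI)
    \<comment> \<open>Under this rotation the side Im t = X becomes a vertical side, treated by
      \<open>right\<close>, and the sides with |Re t| = X become horizontal ones, treated by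
      \<open>top\<close>.\<close>
    define z where "z = - \<i> * t"
    have z: "Re z = Im t" "Im z = - Re t" "\<i> * z = t" "norm z = norm t"
      by (simp_all add: z_def norm_mult)
    have nt: "norm t \<ge> max \<bar>Re t\<bar> \<bar>Im t\<bar>"
      using abs_Re_le_cmod abs_Im_le_cmod by simp
    {
      assume a: "max \<bar>Re t\<bar> \<bar>Im t\<bar> = X" "X \<ge> X2" "X = pi * Re p / 2 + pi * real N"
      have uz: "norm (u z) \<ge> \<delta> \<and> norm (u1 z) \<le> C * norm (u z)"
      proof (cases "Im t = X")
        case True
        then show ?thesis using right[of X N z] a t z by (auto simp: X2_def)
      next
        case False
        then show ?thesis using top[of z] a t z by (auto simp: X2_def max_def split: if_splits)
      qed
      have z1: "norm z \<ge> 1" using nt a z by (auto simp: X2_def)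
      then have "z \<noteq> 0" by auto
      moreover have "\<delta> \<le> norm (z powr p * dunkl_I \<nu> t)" using uz by (simp add: u_def z(3))
      ultimately show "norm (dunkl_I \<nu> t) \<ge> \<delta> / M * norm t powr - Re p"
        using lower[of z "dunkl_I \<nu> t"] by (simp only: z(4) simp_thms)
      show "norm (deriv (dunkl_I \<nu>) t) \<le> C' * norm (dunkl_I \<nu> t)"
        using ratio[OF z1] uz by (simp only: z(3) simp_thms)
    }
    {
      assume "X2 \<le> \<bar>Re t\<bar>" "\<bar>Im t\<bar> \<le> \<bar>Re t\<bar>"
      then have "norm (u z) \<ge> \<delta>" using top[of z] t z(1,2) by (simp add: X2_def)
      moreover have "u z = 0" if "dunkl_I \<nu> t = 0" using that by (simp add: u_def z(3))
      ultimately show "dunkl_I \<nu> t \<noteq> 0" using \<delta> by fastforce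
    }
    assume a: "max \<bar>Re t\<bar> \<bar>Im t\<bar> \<ge> X2" "dunkl_I \<nu> t = 0"
    have "u z = 0" using a by (simp add: u_def z(3))
    moreover have "max (Re z) \<bar>Im z\<bar> \<ge> X1" "Re z \<ge> 0"
      using a(1) t unfolding z(1,2) X2_def by linarith+
    ultimately have "norm (u1 z) \<ge> \<delta>" using zero by blast
    moreover have "norm z > 0" using nt a(1) unfolding z(4) X2_def by linarith
    moreover have "u1 z = z powr p * (\<i> * deriv (dunkl_I \<nu>) t)" by (simp add: u1_def z(3) a(2))
    ultimately have "\<delta> / M * norm z powr - Re p \<le> norm (\<i> * deriv (dunkl_I \<nu>) t)"
      using lower[of z "\<i> * deriv (dunkl_I \<nu>) t"] by simp
    then show "norm (deriv (dunkl_I \<nu>) t) \<ge> \<delta> / M * norm t powr - Re p"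
      by (simp add: norm_mult z(4))
  qed
  note upper = this
  \<comment> \<open>The estimates for u hold in the half-plane Re z \<ge> 0, that is Im t \<ge> 0;
    evenness supplies the other half.\<close>
  have all: "?P X N t" for t X N
  proof (cases "Im t \<ge> 0")
    case False
    then show ?thesis
      using upper[of "- t" X N] by (simp add: dunkl_I_minus deriv_dunkl_I_minus[OF \<nu>])
  qed (use upper in blast)
  show thesis
  proof (rule that[of "\<delta> / M" X2 C'])
    show "\<delta> / M > 0" "X2 > 0" using \<delta> M by (simp_all add: X2_def)
  qed (use all[unfolded Rep] in blast)+
qed

section \<open>Contour integrals over squares and their residues\<close>

lemma norm_contour_integral_square_le:
  assumes f: "continuous_on (path_image (rectpath (Complex (- X) (- X)) (Complex X X))) f"
    and X: "X > 0" and B: "B \<ge> 0"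
    and le: "\<And>t. max \<bar>Re t\<bar> \<bar>Im t\<bar> = X \<Longrightarrow> norm (f t) \<le> B"
  shows "norm (contour_integral (rectpath (Complex (- X) (- X)) (Complex X X)) f) \<le> 8 * X * B"
proof -
  define a1 a2 a3 a4 where "a1 = Complex (- X) (- X)" "a2 = Complex X (- X)" "a3 = Complex X X" "a4 = Complex (- X) X"
  note a = this
  have rp: "rectpath a1 a3 = linepath a1 a2 +++ linepath a2 a3 +++ linepath a3 a4 +++ linepath a4 a1"
    by (simp add: rectpath_def a Let_def)
  have img: "path_image (rectpath a1 a3) = closed_segment a1 a2 \<union> closed_segment a2 a3 \<union> closed_segment a3 a4 \<union> closed_segment a4 a1"
    by (simp add: rp path_image_join Un_assoc)
  have c: "continuous_on (closed_segment a1 a2) f" "continuous_on (closed_segment a2 a3) f"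
      "continuous_on (closed_segment a3 a4) f" "continuous_on (closed_segment a4 a1) f"
    using f unfolding a(1,3)[symmetric] img by (auto intro: continuous_on_subset)
  have ci: "f contour_integrable_on linepath a1 a2" "f contour_integrable_on linepath a2 a3"
      "f contour_integrable_on linepath a3 a4" "f contour_integrable_on linepath a4 a1"
    using c by (auto intro: contour_integrable_continuous_linepath)
  have "path_image (rectpath a1 a3) \<subseteq> {t. max \<bar>Re t\<bar> \<bar>Im t\<bar> = X}"
    using X by (auto simp: path_image_rectpath a)
  then have bd: "norm (f t) \<le> B" if "t \<in> closed_segment a1 a2 \<union> closed_segment a2 a3 \<union> closed_segment a3 a4 \<union> closed_segment a4 a1" for t
    using le that unfolding img by blast
  have "norm (contour_integral (linepath a1 a2) f) \<le> B * norm (a2 - a1)"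
      "norm (contour_integral (linepath a2 a3) f) \<le> B * norm (a3 - a2)"
      "norm (contour_integral (linepath a3 a4) f) \<le> B * norm (a4 - a3)"
      "norm (contour_integral (linepath a4 a1) f) \<le> B * norm (a1 - a4)"
    using ci B bd by (intro contour_integral_bound_linepath; simp)+
  moreover have "norm (a2 - a1) = 2 * X" "norm (a3 - a2) = 2 * X" "norm (a4 - a3) = 2 * X" "norm (a1 - a4) = 2 * X"
    using X by (simp_all add: a cmod_def real_sqrt_mult)
  moreover have "contour_integral (rectpath a1 a3) f = contour_integral (linepath a1 a2) f +
     (contour_integral (linepath a2 a3) f + (contour_integral (linepath a3 a4) f + contour_integral (linepath a4 a1) f))"
    unfolding rp using ci by simp
  moreover have "norm (w1 + (w2 + (w3 + w4))) \<le> norm w1 + (norm w2 + (norm w3 + norm w4))" for w1 w2 w3 w4 :: complex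
    by (intro norm_triangle_mono order_refl)
  ultimately have "norm (contour_integral (rectpath a1 a3) f) \<le> B * (2 * X) + (B * (2 * X) + (B * (2 * X) + B * (2 * X)))"
    by (smt (verit))
  then show ?thesis by (simp add: a mult_ac)
qed

text \<open>Residue theorem: all zeros of \<open>dunkl_I \<nu>\<close> are simple, and dividing by
  t^(n+1) makes the pole at 0 pick out the n-th Taylor coefficient.\<close>

lemma dunkl_residue_sum:
  assumes \<nu>: "\<nu> + 1 \<notin> \<int>\<^sub>\<le>\<^sub>0" and h: "h holomorphic_on UNIV"
    and hz: "\<And>t. dunkl_I \<nu> t = 0 \<Longrightarrow> h t \<noteq> 0" and X: "X > 0"
    and bdry: "\<And>t. max \<bar>Re t\<bar> \<bar>Im t\<bar> = X \<Longrightarrow> dunkl_I \<nu> t \<noteq> 0"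
  defines "Z \<equiv> {t. dunkl_I \<nu> t = 0 \<and> \<bar>Re t\<bar> < X \<and> \<bar>Im t\<bar> < X}"
  defines "F \<equiv> \<lambda>n t. h t / dunkl_I \<nu> t / t ^ Suc n"
  shows "finite Z"
    and "contour_integral (rectpath (Complex (- X) (- X)) (Complex X X)) (F n) =
      2 * pi * \<i> * ((\<Sum>r\<in>Z. h r / (deriv (dunkl_I \<nu>) r * r ^ Suc n)) +
        fps_nth (fps_expansion (\<lambda>t. h t / dunkl_I \<nu> t) 0) n)"
    and "continuous_on (path_image (rectpath (Complex (- X) (- X)) (Complex X X))) (F n)"
proof -
  define g where "g = rectpath (Complex (- X) (- X)) (Complex X X)"
  \<comment> \<open>A disc of this radius contains the closed square. It may hold further zeros, so
    P can exceed Z, but around these the winding number is 0.\<close>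
  define R where "R = 2 * X + 1"
  define P where "P = {t \<in> cball 0 R. dunkl_I \<nu> t = 0}"
  note I0 = dunkl_I_0[OF \<nu>]
  have holI: "dunkl_I \<nu> holomorphic_on S" for S
    using holomorphic_dunkl_I holomorphic_on_subset by blast
  have holh: "h holomorphic_on S" for S
    using h holomorphic_on_subset by blast
  have "\<not> dunkl_I \<nu> constant_on UNIV"
  proof
    assume "dunkl_I \<nu> constant_on UNIV"
    then have c: "dunkl_I \<nu> = (\<lambda>t. 1)" using I0 unfolding constant_on_def by (metis UNIV_I ext)
    have "deriv (dunkl_I \<nu>) = (\<lambda>t. 0)" unfolding c by auto
    \<comment> \<open>For the constant function 1 the differential equation at t = 1 would read 0 =
      1.\<close>
    with DERIV_deriv_dunkl_I[OF \<nu>, of 1] have "((\<lambda>t. 0) has_field_derivative 1) (at (1::complex))"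
      by (simp add: c)
    moreover have "((\<lambda>t. 0) has_field_derivative 0) (at (1::complex))" by simp
    ultimately show False using DERIV_unique zero_neq_one by metis
  qed
  then have finP: "finite P"
    unfolding P_def by (intro holomorphic_compact_finite_zeros[OF holI, of UNIV]) auto
  have norm_le: "norm t \<le> 2 * max \<bar>Re t\<bar> \<bar>Im t\<bar>" for t
    using cmod_le[of t] by (simp add: max_def)
  have ZP: "Z \<subseteq> P"
  proof
    fix t assume "t \<in> Z"
    then show "t \<in> P" using norm_le[of t] X by (auto simp: Z_def P_def R_def max_def split: if_splits)
  qed
  then show finZ: "finite Z" using finP finite_subset by blast
  have gim: "path_image g \<subseteq> {t. max \<bar>Re t\<bar> \<bar>Im t\<bar> = X}"
    unfolding g_def using X by (auto simp: path_image_rectpath)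
  have gS: "path_image g \<subseteq> ball 0 R - insert 0 P"
  proof
    fix t assume t: "t \<in> path_image g"
    then have "max \<bar>Re t\<bar> \<bar>Im t\<bar> = X" using gim by auto
    then show "t \<in> ball 0 R - insert 0 P"
      using norm_le[of t] bdry[of t] X by (auto simp: P_def R_def)
  qed
  have holF: "F n holomorphic_on ball 0 R - insert 0 P"
    unfolding F_def by (intro holomorphic_intros holI holh) (auto simp: P_def)
  then show "continuous_on (path_image (rectpath (Complex (- X) (- X)) (Complex X X))) (F n)"
    using gS holomorphic_on_imp_continuous_on holomorphic_on_subset unfolding g_def by blast
  have "winding_number g z = 0" if "z \<notin> ball 0 R" for z
  proof -
    have "norm z > 2 * X" using that X by (simp add: R_def)
    then have "max \<bar>Re z\<bar> \<bar>Im z\<bar> > X" using norm_le[of z] by simp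
    then show ?thesis unfolding g_def
      using X by (intro winding_number_rectpath_outside) (auto simp: in_cbox_complex_iff)
  qed
  then have "contour_integral g (F n) = 2 * pi * \<i> * (\<Sum>r\<in>insert 0 P. winding_number g r * residue (F n) r)"
    using finP gS by (intro Residue_theorem[OF _ _ _ holF]) (auto simp: g_def)
  also have "(\<Sum>r\<in>insert 0 P. winding_number g r * residue (F n) r) = (\<Sum>r\<in>insert 0 Z. residue (F n) r)"
  proof (rule sum.mono_neutral_cong_right)
    show "\<forall>r\<in>insert 0 P - insert 0 Z. winding_number g r * residue (F n) r = 0"
    proof
      fix r assume r: "r \<in> insert 0 P - insert 0 Z"
      then have "max \<bar>Re r\<bar> \<bar>Im r\<bar> \<noteq> X" using bdry by (auto simp: P_def)
      then have "max \<bar>Re r\<bar> \<bar>Im r\<bar> > X" using r by (auto simp: P_def Z_def)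
      then have "winding_number g r = 0" unfolding g_def
        using X by (intro winding_number_rectpath_outside) (auto simp: in_cbox_complex_iff)
      then show "winding_number g r * residue (F n) r = 0" by simp
    qed
    fix r assume r: "r \<in> insert 0 Z"
    have "winding_number g r = 1" unfolding g_def
      using r X by (intro winding_number_rectpath) (auto simp: Z_def in_box_complex_iff)
    then show "winding_number g r * residue (F n) r = residue (F n) r" by simp
  qed (use finP ZP in auto)
  also have "\<dots> = residue (F n) 0 + (\<Sum>r\<in>Z. residue (F n) r)"
    using finZ I0 by (subst sum.insert) (auto simp: Z_def)
  also have "residue (F n) 0 = fps_nth (fps_expansion (\<lambda>t. h t / dunkl_I \<nu> t) 0) n"
    unfolding F_def
  proof (rule residue_fps_expansion_over_power_at_0)
    have "(\<lambda>t. h t / dunkl_I \<nu> t) analytic_on {0}"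
      using I0 h holomorphic_dunkl_I[of \<nu>] by (intro analytic_on_divide) (auto simp: analytic_on_holomorphic)
    then show "(\<lambda>t. h t / dunkl_I \<nu> t) has_fps_expansion fps_expansion (\<lambda>t. h t / dunkl_I \<nu> t) 0"
      by (rule analytic_at_imp_has_fps_expansion_0)
  qed
  also have "(\<Sum>r\<in>Z. residue (F n) r) = (\<Sum>r\<in>Z. h r / (deriv (dunkl_I \<nu>) r * r ^ Suc n))"
  proof (rule sum.cong)
    fix r assume "r \<in> Z"
    then have r: "dunkl_I \<nu> r = 0" by (simp add: Z_def)
    note rs = dunkl_I_zero_simple[OF \<nu> r]
    have "residue (\<lambda>t. (h t / t ^ Suc n) / dunkl_I \<nu> t) r = (h r / r ^ Suc n) / deriv (dunkl_I \<nu>) r"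
    proof (rule residue_simple_pole_deriv[where s = "ball r (norm r)"])
      show "(\<lambda>t. h t / t ^ Suc n) holomorphic_on ball r (norm r)"
        by (intro holomorphic_intros holh) auto
      show "(dunkl_I \<nu> has_field_derivative deriv (dunkl_I \<nu>) r) (at r)"
        using holI[of UNIV] holomorphic_derivI by blast
    qed (use rs r holI hz in auto)
    also have "(\<lambda>t. (h t / t ^ Suc n) / dunkl_I \<nu> t) = F n" by (simp add: F_def fun_eq_iff)
    finally show "residue (F n) r = h r / (deriv (dunkl_I \<nu>) r * r ^ Suc n)" by (simp add: mult.commute)
  qed simp
  finally show "contour_integral (rectpath (Complex (- X) (- X)) (Complex X X)) (F n) =
      2 * pi * \<i> * ((\<Sum>r\<in>Z. h r / (deriv (dunkl_I \<nu>) r * r ^ Suc n)) +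
        fps_nth (fps_expansion (\<lambda>t. h t / dunkl_I \<nu> t) 0) n)"
    by (simp add: g_def add.commute)
qed

subsection \<open>The zeros\<close>

locale dunkl_zeros =
  fixes \<nu> :: complex and s :: "int \<Rightarrow> complex"
  assumes \<nu>: "\<nu> + 1 \<notin> \<int>\<^sub>\<le>\<^sub>0"
    and zeros: "bij_betw s (UNIV - {0}) {z. dunkl_I \<nu> (\<i> * z) = 0}"
    and odd: "\<And>j. j \<noteq> 0 \<Longrightarrow> s (- j) = - s j"
    and ordered: "\<And>j. j \<ge> 1 \<Longrightarrow> 0 \<le> Re (s j) \<and> Re (s j) \<le> Re (s (j + 1))"
begin

text \<open>The index j stands for the zero number j + 1, since s starts at 1. The factor i turns
  the ordering by real parts into one by imaginary parts.\<close>

definition r :: "nat \<Rightarrow> complex" where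
  "r j = \<i> * s (int j + 1)"

lemma r_zero: "dunkl_I \<nu> (r j) = 0"
  using bij_betwE[OF zeros] by (auto simp: r_def)

lemma zero_cases:
  assumes "dunkl_I \<nu> t = 0"
  obtains j where "t = r j" | j where "t = - r j"
proof -
  have "- \<i> * t \<in> {z. dunkl_I \<nu> (\<i> * z) = 0}"
    using assms by (simp flip: mult.assoc)
  then have "- \<i> * t \<in> s ` (UNIV - {0})"
    using bij_betw_imp_surj_on[OF zeros] by simp
  then obtain j where j: "j \<noteq> 0" "- \<i> * t = s j" by auto
  then have t: "t = \<i> * s j" by (metis (no_types, lifting) complex_i_mult_minus minus_mult_left minus_minus)
  show thesis
  proof (cases "j > 0")
    case True
    then have "t = r (nat (j - 1))" by (simp add: t r_def)
    then show thesis by (rule that)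
  next
    case False
    then have "t = - r (nat (- j - 1))" using j odd[of "- j"] by (simp add: t r_def)
    then show thesis by (rule that)
  qed
qed

lemma inj_r: "inj r"
proof
  fix i j assume "r i = r j"
  then have "s (int i + 1) = s (int j + 1)" by (simp add: r_def)
  then show "i = j" using bij_betw_imp_inj_on[OF zeros] by (auto dest!: inj_onD)
qed

lemma r_neq: "r i \<noteq> - r j"
proof
  assume "r i = - r j"
  then have "\<i> * s (int i + 1) = \<i> * (- s (int j + 1))" by (simp add: r_def)
  then have "s (int i + 1) = - s (int j + 1)" unfolding mult_cancel_left by simp
  then have "s (int i + 1) = s (- (int j + 1))" using odd[of "int j + 1"] by simp
  then have "int i + 1 = - (int j + 1)"
    using bij_betw_imp_inj_on[OF zeros] by (auto dest!: inj_onD)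
  then show False by simp
qed

lemma Im_r: "0 \<le> Im (r j)" "i \<le> j \<Longrightarrow> Im (r i) \<le> Im (r j)"
proof -
  show "0 \<le> Im (r j)" using ordered[of "int j + 1"] by (simp add: r_def)
  have "Im (r n) \<le> Im (r (Suc n))" for n
    using ordered[of "int n + 1"] by (simp add: r_def add_ac)
  then show "i \<le> j \<Longrightarrow> Im (r i) \<le> Im (r j)"
    by (rule lift_Suc_mono_le)
qed

text \<open>The half-widths of \<open>dunkl_I_square_bounds\<close>, spaced by pi. They can be
  negative for small N, so statements about squares hold from some N0 on.\<close>

definition X :: "nat \<Rightarrow> real" where
  "X N = pi * (Re \<nu> + 1 / 2) / 2 + pi * real N"

lemma X_add: "X (N + M) = X N + pi * real M"
  by (simp add: X_def algebra_simps)

lemma X_at_top: "filterlim X at_top sequentially"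
  unfolding X_def by real_asymp

definition Z :: "nat \<Rightarrow> complex set" where
  "Z N = {t. dunkl_I \<nu> t = 0 \<and> \<bar>Re t\<bar> < X N \<and> \<bar>Im t\<bar> < X N}"

definition A :: "nat \<Rightarrow> nat set" where
  "A N = {j. Im (r j) < X N}"

text \<open>Under this condition the imaginary part alone decides whether a zero lies in the N-th
  square, so the square is described by the index set \<open>A N\<close> and its reflection.\<close>

definition strip :: "nat \<Rightarrow> bool" where
  "strip N \<longleftrightarrow> (\<forall>t. dunkl_I \<nu> t = 0 \<longrightarrow> \<bar>Im t\<bar> < X N \<longrightarrow> \<bar>Re t\<bar> < X N)"

lemma contour_bounds:
  obtains \<delta> C N0 where "\<delta> > 0" "X N0 > 0"
    "\<And>N t. N \<ge> N0 \<Longrightarrow> max \<bar>Re t\<bar> \<bar>Im t\<bar> = X N \<Longrightarrow> dunkl_I \<nu> t \<noteq> 0"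
    "\<And>N t. N \<ge> N0 \<Longrightarrow> max \<bar>Re t\<bar> \<bar>Im t\<bar> = X N \<Longrightarrow> norm (dunkl_I \<nu> t) \<ge> \<delta> * norm t powr - (Re \<nu> + 1 / 2)"
    "\<And>N t. N \<ge> N0 \<Longrightarrow> max \<bar>Re t\<bar> \<bar>Im t\<bar> = X N \<Longrightarrow> norm (deriv (dunkl_I \<nu>) t) \<le> C * norm (dunkl_I \<nu> t)"
    "\<And>N. N \<ge> N0 \<Longrightarrow> strip N"
    "\<And>t. dunkl_I \<nu> t = 0 \<Longrightarrow> \<bar>Im t\<bar> \<ge> X N0 \<Longrightarrow> norm (deriv (dunkl_I \<nu>) t) \<ge> \<delta> * norm t powr - (Re \<nu> + 1 / 2)"
proof -
  obtain \<delta> C X1 where \<delta>: "\<delta> > 0" and X1: "X1 > 0" and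
    sq: "\<And>X N t. X \<ge> X1 \<Longrightarrow> X = pi * (Re \<nu> + 1 / 2) / 2 + pi * real N \<Longrightarrow> max \<bar>Re t\<bar> \<bar>Im t\<bar> = X \<Longrightarrow>
       norm (dunkl_I \<nu> t) \<ge> \<delta> * norm t powr - (Re \<nu> + 1 / 2) \<and>
       norm (deriv (dunkl_I \<nu>) t) \<le> C * norm (dunkl_I \<nu> t)" and
    side: "\<And>t. X1 \<le> \<bar>Re t\<bar> \<Longrightarrow> \<bar>Im t\<bar> \<le> \<bar>Re t\<bar> \<Longrightarrow> dunkl_I \<nu> t \<noteq> 0" and
    zero: "\<And>t. max \<bar>Re t\<bar> \<bar>Im t\<bar> \<ge> X1 \<Longrightarrow> dunkl_I \<nu> t = 0 \<Longrightarrow>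
       norm (deriv (dunkl_I \<nu>) t) \<ge> \<delta> * norm t powr - (Re \<nu> + 1 / 2)"
    by (rule dunkl_I_square_bounds[OF \<nu>]) blast
  obtain N0 where N0: "X N \<ge> X1" if "N \<ge> N0" for N
    using X_at_top by (auto simp: filterlim_at_top eventually_sequentially)
  show thesis
  proof (rule that[of \<delta> N0 C])
    fix N t assume N: "N \<ge> N0" and t: "max \<bar>Re t\<bar> \<bar>Im t\<bar> = X N"
    note * = sq[OF N0[OF N] X_def t]
    then show "norm (dunkl_I \<nu> t) \<ge> \<delta> * norm t powr - (Re \<nu> + 1 / 2)"
      "norm (deriv (dunkl_I \<nu>) t) \<le> C * norm (dunkl_I \<nu> t)" by auto
    have "t \<noteq> 0" using t N0[OF N] X1 by auto
    then have "\<delta> * norm t powr - (Re \<nu> + 1 / 2) > 0" using \<delta> by simp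
    with * show "dunkl_I \<nu> t \<noteq> 0" by auto
  next
    fix N assume "N \<ge> N0"
    then have "X N \<ge> X1" using N0 by simp
    then show "strip N" unfolding strip_def using side by (meson le_less_linear less_le_trans less_imp_le order_trans)
  next
    fix t assume "dunkl_I \<nu> t = 0" "\<bar>Im t\<bar> \<ge> X N0"
    then show "norm (deriv (dunkl_I \<nu>) t) \<ge> \<delta> * norm t powr - (Re \<nu> + 1 / 2)"
      using N0[of N0] by (intro zero) auto
  qed (use \<delta> N0[of N0] X1 in auto)
qed

lemma Z_eq:
  assumes "strip N"
  shows "Z N = r ` A N \<union> (\<lambda>j. - r j) ` A N"
proof
  show "Z N \<subseteq> r ` A N \<union> (\<lambda>j. - r j) ` A N"
    by (auto simp: Z_def A_def elim!: zero_cases)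
  show "r ` A N \<union> (\<lambda>j. - r j) ` A N \<subseteq> Z N"
    using assms r_zero Im_r(1) by (auto simp: strip_def Z_def A_def dunkl_I_minus)
qed

lemma sum_Z:
  fixes g :: "complex \<Rightarrow> 'b :: comm_monoid_add"
  assumes "strip N" "finite (Z N)"
  shows "finite (A N)" "sum g (Z N) = (\<Sum>j\<in>A N. g (r j) + g (- r j))"
proof -
  note Z = Z_eq[OF assms(1)]
  have "finite (r ` A N)" using assms(2) by (simp add: Z)
  then show fin: "finite (A N)" by (rule finite_imageD) (rule inj_on_subset[OF inj_r], simp)
  have "sum g (Z N) = sum g (r ` A N) + sum g ((\<lambda>j. - r j) ` A N)"
    unfolding Z by (rule sum.union_disjoint) (use fin r_neq in auto)
  also have "sum g (r ` A N) = (\<Sum>j\<in>A N. g (r j))"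
    by (subst sum.reindex) (auto intro: inj_on_subset[OF inj_r])
  also have "sum g ((\<lambda>j. - r j) ` A N) = (\<Sum>j\<in>A N. g (- r j))"
    using inj_r by (subst sum.reindex) (auto simp: inj_on_def)
  finally show "sum g (Z N) = (\<Sum>j\<in>A N. g (r j) + g (- r j))"
    by (simp add: sum.distrib)
qed

lemma holomorphic_dunkl_I_on: "dunkl_I \<nu> holomorphic_on S"
  using holomorphic_dunkl_I holomorphic_on_subset by blast

text \<open>The argument principle bounds the number of zeros in the \<open>N\<close>-th square by a multiple of \<open>X N\<close>,
  and since the zeros are ordered by \<open>Im (r j)\<close>, this turns into a growth bound.\<close>

lemma r_growth:
  obtains c K where "c > 0" "\<And>j. Im (r j) \<ge> c * real (Suc j) - K"
proof -
  obtain \<delta> C N0 where XN0: "X N0 > 0" and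
    nz: "\<And>N t. N \<ge> N0 \<Longrightarrow> max \<bar>Re t\<bar> \<bar>Im t\<bar> = X N \<Longrightarrow> dunkl_I \<nu> t \<noteq> 0" and
    bd: "\<And>N t. N \<ge> N0 \<Longrightarrow> max \<bar>Re t\<bar> \<bar>Im t\<bar> = X N \<Longrightarrow> norm (deriv (dunkl_I \<nu>) t) \<le> C * norm (dunkl_I \<nu> t)" and
    re: "\<And>N. N \<ge> N0 \<Longrightarrow> strip N"
    by (rule contour_bounds) blast
  define C' where "C' = max 1 C"
  have count: "real (card (A N)) \<le> C' * X N" "finite (A N)" if N: "N \<ge> N0" for N
  proof -
    have XN: "X N > 0" using X_add[of N0 "N - N0"] N XN0 by (simp add: add_pos_nonneg)
    \<comment> \<open>With h = t I' and n = 0 the integrand is the logarithmic derivative away from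
      0. Every zero contributes 1, and the factor t makes the coefficient at 0 vanish.\<close>
    define F where "F = (\<lambda>t. t * deriv (dunkl_I \<nu>) t / dunkl_I \<nu> t / t ^ Suc 0)"
    have hol: "(\<lambda>t. t * deriv (dunkl_I \<nu>) t) holomorphic_on UNIV"
      by (intro holomorphic_intros holomorphic_deriv holomorphic_dunkl_I_on) auto
    note * = dunkl_residue_sum(1)[OF \<nu> hol _ XN nz[OF N], folded Z_def]
      dunkl_residue_sum(2,3)[OF \<nu> hol _ XN nz[OF N], where n = 0, folded Z_def F_def]
    have hz: "t * deriv (dunkl_I \<nu>) t \<noteq> 0" if "dunkl_I \<nu> t = 0" for t
      using dunkl_I_zero_simple[OF \<nu> that] by simp
    have fin: "finite (Z N)" and int: "contour_integral (rectpath (Complex (- X N) (- X N)) (Complex (X N) (X N))) F =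
      2 * pi * \<i> * ((\<Sum>t\<in>Z N. t * deriv (dunkl_I \<nu>) t / (deriv (dunkl_I \<nu>) t * t ^ Suc 0)) +
        fps_nth (fps_expansion (\<lambda>t. t * deriv (dunkl_I \<nu>) t / dunkl_I \<nu> t) 0) 0)"
      and cont: "continuous_on (path_image (rectpath (Complex (- X N) (- X N)) (Complex (X N) (X N)))) F"
      using *[OF hz] by simp_all
    have "(\<Sum>t\<in>Z N. t * deriv (dunkl_I \<nu>) t / (deriv (dunkl_I \<nu>) t * t ^ Suc 0)) = (\<Sum>t\<in>Z N. 1)"
      using hz by (intro sum.cong) (auto simp: Z_def)
    also have "\<dots> = 2 * of_nat (card (A N))"
      using sum_Z(2)[OF re[OF N] fin, of "\<lambda>_. 1 :: complex"] by simp
    finally have "contour_integral (rectpath (Complex (- X N) (- X N)) (Complex (X N) (X N))) F = 4 * pi * \<i> * of_nat (card (A N))"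
      unfolding int by (simp add: fps_expansion_def)
    then have "4 * pi * real (card (A N)) = norm (contour_integral (rectpath (Complex (- X N) (- X N)) (Complex (X N) (X N))) F)"
      by (simp add: norm_mult)
    also have "\<dots> \<le> 8 * X N * C'"
    proof (rule norm_contour_integral_square_le[OF cont XN])
      show "C' \<ge> 0" by (simp add: C'_def)
      fix t assume t: "max \<bar>Re t\<bar> \<bar>Im t\<bar> = X N"
      then have "t \<noteq> 0" using XN by auto
      then have "norm (F t) = norm (deriv (dunkl_I \<nu>) t) / norm (dunkl_I \<nu> t)"
        by (simp add: F_def norm_divide)
      also have "\<dots> \<le> C" using bd[OF N t] nz[OF N t] by (simp add: field_simps)
      finally show "norm (F t) \<le> C'" by (simp add: C'_def)
    qed
    finally have "pi * real (card (A N)) \<le> 2 * (C' * X N)" by simp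
    moreover have "2 * real (card (A N)) \<le> pi * real (card (A N))"
      using pi_ge_two by (intro mult_right_mono) auto
    ultimately show "real (card (A N)) \<le> C' * X N" by linarith
    show "finite (A N)" by (rule sum_Z(1)[OF re[OF N] fin])
  qed
  have C': "C' > 0" by (simp add: C'_def)
  show thesis
  proof (rule that[of "1 / C'" "X N0 + pi"])
    fix j
    \<comment> \<open>Just large enough for square N0 + M to catch all zeros up to r j, while its
      half-width exceeds Im (r j) by at most X N0 + pi.\<close>
    define M where "M = Suc (nat \<lfloor>Im (r j) / pi\<rfloor>)"
    have "real (nat \<lfloor>Im (r j) / pi\<rfloor>) = of_int \<lfloor>Im (r j) / pi\<rfloor>" using Im_r(1)[of j] by simp
    then have "Im (r j) / pi < real M" "real M \<le> Im (r j) / pi + 1"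
      unfolding M_def using floor_correct[of "Im (r j) / pi"] by linarith+
    then have M: "Im (r j) < pi * real M" "pi * real M \<le> Im (r j) + pi"
      by (simp_all add: field_simps)
    have "{..j} \<subseteq> A (N0 + M)"
      unfolding A_def X_add using Im_r(2)[of _ j] M XN0 by fastforce
    then have "real (Suc j) \<le> real (card (A (N0 + M)))"
      using card_mono[OF count(2)[of "N0 + M"], of "{..j}"] by simp
    also have "\<dots> \<le> C' * X (N0 + M)" by (rule count) simp
    also have "\<dots> \<le> C' * (X N0 + (Im (r j) + pi))"
      unfolding X_add using M C' by (intro mult_left_mono) auto
    finally show "Im (r j) \<ge> 1 / C' * real (Suc j) - (X N0 + pi)"
      using C' by (simp add: field_simps)
  qed (use C' in simp)
qed

lemma r_at_top: "filterlim (\<lambda>j. Im (r j)) at_top sequentially"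
proof -
  obtain c K where c: "c > 0" "\<And>j. Im (r j) \<ge> c * real (Suc j) - K"
    using r_growth by blast
  have "filterlim (\<lambda>j. c * real (Suc j) - K) at_top sequentially"
    using c(1) by real_asymp
  then show ?thesis
    by (rule filterlim_at_top_mono) (use c(2) in auto)
qed

lemma summable_powr_r:
  assumes "q > 1"
  shows "summable (\<lambda>j. norm (r j) powr - q)"
proof -
  obtain c K where c: "c > 0" "\<And>j. Im (r j) \<ge> c * real (Suc j) - K"
    using r_growth by blast
  \<comment> \<open>Halving the slope absorbs the constant K and leaves a pure multiple of j + 1 to
    compare with.\<close>
  have ev: "eventually (\<lambda>j. c * real (Suc j) - K \<ge> c / 2 * real (Suc j)) sequentially"
    using c(1) by real_asymp
  have sm: "summable (\<lambda>j. (c / 2) powr - q * real (Suc j) powr - q)"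
    using assms summable_real_powr_iff[of "- q"]
    by (intro summable_mult) (simp add: summable_Suc_iff[of "\<lambda>n. real n powr - q"] del: of_nat_Suc)
  have "norm (norm (r j) powr - q) \<le> (c / 2) powr - q * real (Suc j) powr - q"
    if "c * real (Suc j) - K \<ge> c / 2 * real (Suc j)" for j
  proof -
    have "c / 2 * real (Suc j) \<le> norm (r j)"
      using that c(2)[of j] abs_Im_le_cmod[of "r j"] by linarith
    then have "norm (r j) powr - q \<le> (c / 2 * real (Suc j)) powr - q"
      using c(1) assms by (intro powr_mono2') (auto simp del: of_nat_Suc)
    also have "\<dots> = (c / 2) powr - q * real (Suc j) powr - q"
      by (rule powr_mult)
    finally show ?thesis by simp
  qed
  then show ?thesis
    by (rule summable_comparison_test_ev[OF eventually_mono[OF ev] sm])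
qed

text \<open>The integrals over the squares tend to 0, so the residues inside tend to minus the one
  at 0; \<open>a\<close> is the simplified residue, and its evenness merges r and -r. This is a
  limit along the blocks \<open>A N\<close> only. Each finite index set lies in \<open>A N\<close>
  eventually, so absolute summability identifies the limit with the sum of the series.\<close>

lemma zero_sum:
  fixes h :: "complex \<Rightarrow> complex" and n :: nat and a :: "complex \<Rightarrow> complex"
  assumes h: "h holomorphic_on UNIV" and hz: "\<And>t. dunkl_I \<nu> t = 0 \<Longrightarrow> h t \<noteq> 0"
    and small: "((\<lambda>N. X N * B N) \<longlongrightarrow> 0) sequentially"
    and B: "\<forall>\<^sub>F N in sequentially. \<forall>t. max \<bar>Re t\<bar> \<bar>Im t\<bar> = X N \<longrightarrow> norm (h t / dunkl_I \<nu> t / t ^ Suc n) \<le> B N"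
    and a: "\<And>t. dunkl_I \<nu> t = 0 \<Longrightarrow> h t / (deriv (dunkl_I \<nu>) t * t ^ Suc n) = a t"
    and even: "\<And>t. a (- t) = a t"
    and summable: "summable (\<lambda>j. norm (a (r j)))"
  shows "(\<lambda>j. 2 * a (r j)) sums - fps_nth (fps_expansion (\<lambda>t. h t / dunkl_I \<nu> t) 0) n"
proof -
  define c where "c = fps_nth (fps_expansion (\<lambda>t. h t / dunkl_I \<nu> t) 0) n"
  obtain N0 where XN0: "X N0 > 0" and
    nz: "\<And>N t. N \<ge> N0 \<Longrightarrow> max \<bar>Re t\<bar> \<bar>Im t\<bar> = X N \<Longrightarrow> dunkl_I \<nu> t \<noteq> 0" and
    re: "\<And>N. N \<ge> N0 \<Longrightarrow> strip N"
    by (rule contour_bounds) blast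
  have XN: "X N > 0" if "N \<ge> N0" for N
    using X_add[of N0 "N - N0"] that XN0 by (simp add: add_pos_nonneg)
  define F where "F = (\<lambda>t. h t / dunkl_I \<nu> t / t ^ Suc n)"
  define J where "J = (\<lambda>N. contour_integral (rectpath (Complex (- X N) (- X N)) (Complex (X N) (X N))) F)"
  have fin: "finite (A N)" and J: "J N = 2 * pi * \<i> * ((\<Sum>j\<in>A N. 2 * a (r j)) + c)"
    and cont: "continuous_on (path_image (rectpath (Complex (- X N) (- X N)) (Complex (X N) (X N)))) F"
    if N: "N \<ge> N0" for N
  proof -
    note * = dunkl_residue_sum(1)[OF \<nu> h hz XN[OF N] nz[OF N], folded Z_def, simplified]
      dunkl_residue_sum(2,3)[OF \<nu> h hz XN[OF N] nz[OF N], where n = n, folded Z_def F_def c_def, simplified]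
    show "finite (A N)" by (rule sum_Z(1)[OF re[OF N] *(1)])
    show "continuous_on (path_image (rectpath (Complex (- X N) (- X N)) (Complex (X N) (X N)))) F"
      by (rule *(3))
    have "J N = 2 * pi * \<i> * ((\<Sum>t\<in>Z N. h t / (deriv (dunkl_I \<nu>) t * t ^ Suc n)) + c)"
      using *(2) by (simp add: J_def)
    also have "(\<Sum>t\<in>Z N. h t / (deriv (dunkl_I \<nu>) t * t ^ Suc n)) = (\<Sum>t\<in>Z N. a t)"
      by (intro sum.cong refl a) (simp add: Z_def)
    also have "\<dots> = (\<Sum>j\<in>A N. 2 * a (r j))"
      unfolding sum_Z(2)[OF re[OF N] *(1)] by (simp add: even)
    finally show "J N = 2 * pi * \<i> * ((\<Sum>j\<in>A N. 2 * a (r j)) + c)" .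
  qed
  have "(J \<longlongrightarrow> 0) sequentially"
  proof (rule tendsto_0_le)
    show "((\<lambda>N. X N * B N) \<longlongrightarrow> 0) sequentially" by (rule small)
    show "\<forall>\<^sub>F N in sequentially. norm (J N) \<le> norm (X N * B N) * 8"
      using B eventually_ge_at_top[of N0]
    proof eventually_elim
      case (elim N)
      \<comment> \<open>The point X N of the contour serves to show that B N is nonnegative.\<close>
      then have "norm (F (of_real (X N))) \<le> B N" using XN[of N] unfolding F_def by (auto simp del: power_Suc)
      then have "B N \<ge> 0" using norm_ge_zero order_trans by blast
      moreover from this have "norm (J N) \<le> 8 * X N * B N"
        unfolding J_def using elim XN cont by (intro norm_contour_integral_square_le) (auto simp: F_def simp del: power_Suc)
      ultimately show ?case using XN[of N] elim by simp
    qed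
  qed
  then have "((\<lambda>N. J N / (2 * pi * \<i>) - c) \<longlongrightarrow> 0 / (2 * pi * \<i>) - c) sequentially"
    by (intro tendsto_intros) auto
  moreover have "\<forall>\<^sub>F N in sequentially. J N / (2 * pi * \<i>) - c = (\<Sum>j\<in>A N. 2 * a (r j))"
    using eventually_ge_at_top[of N0] by eventually_elim (simp add: J)
  ultimately have lim: "((\<lambda>N. \<Sum>j\<in>A N. 2 * a (r j)) \<longlongrightarrow> - c) sequentially"
    by (auto dest: tendsto_cong)
  have sm: "summable (\<lambda>j. norm (2 * a (r j)))"
    using summable_mult[OF summable, of 2] by (simp add: norm_mult)
  obtain S where S: "(\<lambda>j. 2 * a (r j)) sums S"
    using summable_sums[OF summable_norm_cancel[OF sm]] by blast
  have "((\<lambda>j. 2 * a (r j)) has_sum S) UNIV"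
    using sm S by (rule norm_summable_imp_has_sum)
  moreover have "filterlim A (finite_subsets_at_top UNIV) sequentially"
  proof (rule filterlim_finite_subsets_at_top[THEN iffD2], intro allI impI)
    fix Y :: "nat set" assume Y: "finite Y \<and> Y \<subseteq> UNIV"
    have "\<forall>\<^sub>F N in sequentially. \<forall>j\<in>Y. Im (r j) < X N"
      using Y X_at_top by (intro eventually_ball_finite) (auto simp: filterlim_at_top_dense)
    then show "\<forall>\<^sub>F N in sequentially. finite (A N) \<and> Y \<subseteq> A N \<and> A N \<subseteq> UNIV"
      using eventually_ge_at_top[of N0] by eventually_elim (use fin in \<open>auto simp: A_def\<close>)
  qed
  ultimately have "((\<lambda>N. \<Sum>j\<in>A N. 2 * a (r j)) \<longlongrightarrow> S) sequentially"
    unfolding has_sum_def by (rule filterlim_compose)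
  with lim have "S = - c" using LIMSEQ_unique by blast
  then show ?thesis using S by (simp add: c_def)
qed

end

section \<open>The two series, with h = E(t) and h = 1\<close>

theorem theorem4p1:
  fixes \<alpha> :: complex and s :: "int \<Rightarrow> complex" and k :: nat
  assumes alpha: "\<alpha> \<notin> {- of_nat m | m :: nat. m \<ge> 1}"
    and zeros: "bij_betw s (UNIV - {0}) {z. bessel_J_quot (\<alpha> + 1) z = 0}"
    and odd: "\<And>j. j \<noteq> 0 \<Longrightarrow> s (- j) = - s j"
    and ordered: "\<And>j. j \<ge> 1 \<Longrightarrow> 0 \<le> Re (s j) \<and> Re (s j) \<le> Re (s (j + 1))"
    and k: "k \<ge> 1"
  shows "((\<lambda>j::nat. 1 / s (int j + 1) ^ (2 * k)) sums
            ((-1) ^ (k + 1) / (2 ^ (2 * k) * fact k * pochhammer (\<alpha> + 2) (k - 1))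
              * bernoulli_dunkl \<alpha> (2 * k) 1))
       \<and> (Re \<alpha> < 2 * real k - 3 / 2 \<longrightarrow>
          ((\<lambda>j::nat. 1 / (dunkl_I \<alpha> (\<i> * s (int j + 1)) * s (int j + 1) ^ (2 * k))) sums
            ((-1) ^ (k + 1) / (2 ^ (2 * k) * fact k * pochhammer (\<alpha> + 2) (k - 1))
              * bernoulli_dunkl \<alpha> (2 * k) 0)))"
proof -
  note \<alpha> = plus_one_notin_nonpos_Ints[OF alpha]
  define \<nu> where "\<nu> = \<alpha> + 1"
  have \<nu>: "\<nu> + 1 \<notin> \<int>\<^sub>\<le>\<^sub>0" using \<alpha>(2) by (simp add: \<nu>_def add_ac)
  have \<nu>0: "\<nu> \<noteq> 0" using \<alpha>(1) by (auto simp: \<nu>_def)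
  have "bessel_J_quot \<nu> z = 0 \<longleftrightarrow> dunkl_I \<nu> (\<i> * z) = 0" for z
  proof -
    have "(\<i> * z / 2) ^ (2 * n) = (-1) ^ n * (z / 2) ^ (2 * n)" for n
    proof -
      have "(\<i> * z / 2)\<^sup>2 = (-1) * (z / 2)\<^sup>2" by (simp add: power_divide power_mult_distrib)
      then show ?thesis unfolding power_mult by (simp only: power_mult_distrib)
    qed
    then show ?thesis
      using \<nu> by (simp add: bessel_J_quot_series dunkl_I_def Gamma_eq_zero_iff)
  qed
  then interpret dunkl_zeros \<nu> s
    using zeros odd ordered \<nu> by unfold_locales (simp_all add: \<nu>_def)
  \<comment> \<open>For k \<ge> 1 the first factor \<nu> = \<alpha> + 1 of (\<alpha> + 1)_k splits
    off; it cancels against the \<nu> in the residues.\<close>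
  have \<gamma>: "dunkl_gamma \<alpha> (2 * k) = \<nu> * (2 ^ (2 * k) * fact k * pochhammer (\<alpha> + 2) (k - 1))"
    using k pochhammer_rec[of "\<alpha> + 1" "k - 1"] by (simp add: dunkl_gamma_def \<nu>_def add_ac)
  have result: "(\<lambda>j. f j) sums ((-1) ^ (k + 1) / (2 ^ (2 * k) * fact k * pochhammer (\<alpha> + 2) (k - 1)) * bernoulli_dunkl \<alpha> (2 * k) x)"
    if "(\<lambda>j. 2 * a (r j)) sums - fps_nth (fps_expansion (\<lambda>t. dunkl_E \<alpha> (x * t) / dunkl_I \<nu> t) 0) (2 * k)"
      and f: "\<And>j. 2 * a (r j) = (-1) ^ k / \<nu> * f j" for a f x
  proof -
    define T where "T = 2 ^ (2 * k) * fact k * pochhammer (\<alpha> + 2) (k - 1)"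
    have T: "T \<noteq> 0" using dunkl_gamma_nonzero[OF \<alpha>(1), of "2 * k"] by (auto simp: \<gamma> T_def)
    have "(\<lambda>j. ((-1) ^ k * \<nu>) * ((-1) ^ k / \<nu> * f j)) sums (((-1) ^ k * \<nu>) * (- (bernoulli_dunkl \<alpha> (2 * k) x / (\<nu> * T))))"
      using that(1) dunkl_gamma_nonzero[OF \<alpha>(1), of "2 * k"]
      by (intro sums_mult) (simp add: f bernoulli_dunkl_def \<gamma> \<nu>_def[symmetric] T_def)
    moreover have "((-1) ^ k * \<nu>) * ((-1) ^ k / \<nu> * f j) = f j" for j
      using \<nu>0 by (simp flip: power_mult_distrib mult.assoc)
    moreover have "((-1) ^ k * \<nu>) * (- (bernoulli_dunkl \<alpha> (2 * k) x / (\<nu> * T))) = (-1) ^ (k + 1) / T * bernoulli_dunkl \<alpha> (2 * k) x"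
      using \<nu>0 by simp
    ultimately show ?thesis by (simp only: T_def)
  qed
  have r_pow: "r j ^ (2 * k) = (-1) ^ k * s (int j + 1) ^ (2 * k)" for j
  proof -
    have "(r j)\<^sup>2 = (-1) * (s (int j + 1))\<^sup>2" by (simp add: r_def power_mult_distrib)
    then show ?thesis unfolding power_mult by (simp only: power_mult_distrib)
  qed
  have sgn: "2 * (1 / (2 * \<nu> * ((-1) ^ k * w))) = (-1) ^ k / \<nu> * (1 / w)" for w :: complex
    by (cases "even k") auto
  have I\<alpha>: "dunkl_I \<alpha> t = dunkl_I \<nu> t + t / (2 * \<nu>) * deriv (dunkl_I \<nu>) t" for t
    using dunkl_I_contiguous[OF \<alpha>(1)] by (simp add: \<nu>_def)
  have E: "dunkl_E \<alpha> t = dunkl_I \<alpha> t + t / (2 * \<nu>) * dunkl_I \<nu> t" for t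
    by (simp add: dunkl_E_def \<nu>_def)
  have I\<alpha>_zero: "dunkl_I \<alpha> t = t / (2 * \<nu>) * deriv (dunkl_I \<nu>) t" "t \<noteq> 0" "deriv (dunkl_I \<nu>) t \<noteq> 0" "dunkl_I \<alpha> t \<noteq> 0"
    if "dunkl_I \<nu> t = 0" for t
    using that dunkl_I_zero_simple[OF \<nu> that] \<nu>0 by (auto simp: I\<alpha>)
  obtain \<delta> C N0 where \<delta>: "\<delta> > 0" and XN0: "X N0 > 0" and
    nz: "\<And>N t. N \<ge> N0 \<Longrightarrow> max \<bar>Re t\<bar> \<bar>Im t\<bar> = X N \<Longrightarrow> dunkl_I \<nu> t \<noteq> 0" and
    lower: "\<And>N t. N \<ge> N0 \<Longrightarrow> max \<bar>Re t\<bar> \<bar>Im t\<bar> = X N \<Longrightarrow> norm (dunkl_I \<nu> t) \<ge> \<delta> * norm t powr - (Re \<nu> + 1 / 2)" and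
    ratio: "\<And>N t. N \<ge> N0 \<Longrightarrow> max \<bar>Re t\<bar> \<bar>Im t\<bar> = X N \<Longrightarrow> norm (deriv (dunkl_I \<nu>) t) \<le> C * norm (dunkl_I \<nu> t)" and
    simple: "\<And>t. dunkl_I \<nu> t = 0 \<Longrightarrow> \<bar>Im t\<bar> \<ge> X N0 \<Longrightarrow> norm (deriv (dunkl_I \<nu>) t) \<ge> \<delta> * norm t powr - (Re \<nu> + 1 / 2)"
    by (rule contour_bounds) blast
  have X1: "\<forall>\<^sub>F N in sequentially. N \<ge> N0 \<and> X N \<ge> 1"
    using X_at_top eventually_ge_at_top[of N0] by (auto simp: filterlim_at_top intro: eventually_conj)
  have norm_sq: "X N \<le> norm t" "norm t \<le> 2 * X N" if "max \<bar>Re t\<bar> \<bar>Im t\<bar> = X N" for N t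
    using that abs_Re_le_cmod[of t] abs_Im_le_cmod[of t] cmod_le[of t] by linarith+
  show ?thesis
  proof (intro conjI impI)
    \<comment> \<open>At a zero of \<open>dunkl_I \<nu>\<close>, E reduces to t / (2 \<nu>) times
      the derivative, which cancels the derivative in the denominator of the residue.\<close>
    define a where "a = (\<lambda>t. 1 / (2 * \<nu> * t ^ (2 * k)))"
    have "(\<lambda>j. 2 * a (r j)) sums - fps_nth (fps_expansion (\<lambda>t. dunkl_E \<alpha> (1 * t) / dunkl_I \<nu> t) 0) (2 * k)"
    proof (rule zero_sum)
      show "(\<lambda>t. dunkl_E \<alpha> (1 * t)) holomorphic_on UNIV"
        unfolding E by (intro holomorphic_intros) (use \<nu>0 holomorphic_dunkl_I in auto)
      show "dunkl_E \<alpha> (1 * t) \<noteq> 0" if "dunkl_I \<nu> t = 0" for t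
        using I\<alpha>_zero[OF that] that by (simp add: E)
      \<comment> \<open>The quotient of E by \<open>dunkl_I \<nu>\<close> is 1 + t / (2 \<nu>) (q +
        1) with the logarithmic derivative q bounded by |C|. As |t| \<le> 2 X and X \<ge> 1, it is
        at most the constant times X, and X N * B N is of order X^(1 - 2k).\<close>
      define B where "B = (\<lambda>N. (1 + \<bar>C\<bar> / norm \<nu> + 1 / norm \<nu>) * X N * X N powr - (2 * real k + 1))"
      have "filterlim (\<lambda>N. X N powr - (2 * real k - 1)) (nhds 0) sequentially"
        using k X_at_top by (intro tendsto_neg_powr) auto
      then have "((\<lambda>N. (1 + \<bar>C\<bar> / norm \<nu> + 1 / norm \<nu>) * X N powr - (2 * real k - 1)) \<longlongrightarrow> 0) sequentially"
        by (rule tendsto_mult_right_zero)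
      then show "((\<lambda>N. X N * B N) \<longlongrightarrow> 0) sequentially"
      proof (rule Lim_transform_eventually)
        show "\<forall>\<^sub>F N in sequentially. (1 + \<bar>C\<bar> / norm \<nu> + 1 / norm \<nu>) * X N powr - (2 * real k - 1) = X N * B N"
          using X1
        proof eventually_elim
          case (elim N)
          have "X N powr - (2 * real k - 1) = X N powr (1 + 1 + - (2 * real k + 1))" by simp
          also have "\<dots> = X N * X N * X N powr - (2 * real k + 1)"
            unfolding powr_add using elim by simp
          finally show ?case by (simp add: B_def)
        qed
      qed
      show "\<forall>\<^sub>F N in sequentially. \<forall>t. max \<bar>Re t\<bar> \<bar>Im t\<bar> = X N \<longrightarrow>
          norm (dunkl_E \<alpha> (1 * t) / dunkl_I \<nu> t / t ^ Suc (2 * k)) \<le> B N"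
        using X1
      proof eventually_elim
        case (elim N)
        show ?case
        proof (intro allI impI)
          fix t assume t: "max \<bar>Re t\<bar> \<bar>Im t\<bar> = X N"
          have I: "dunkl_I \<nu> t \<noteq> 0" using nz t elim by blast
          have q: "norm (deriv (dunkl_I \<nu>) t / dunkl_I \<nu> t) \<le> \<bar>C\<bar>"
            using ratio[of N t] t elim I by (simp add: norm_divide field_simps) (smt (verit) mult_right_mono norm_ge_zero)
          have tn: "norm (t / (2 * \<nu>)) \<le> X N / norm \<nu>"
            using norm_sq(2)[OF t] \<nu>0 by (simp add: norm_divide norm_mult field_simps)
          have prod: "norm (t / (2 * \<nu>) * (deriv (dunkl_I \<nu>) t / dunkl_I \<nu> t)) \<le> X N / norm \<nu> * \<bar>C\<bar>"
            unfolding norm_mult[of "t / (2 * \<nu>)"] using elim by (intro mult_mono q tn) auto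
          have "dunkl_E \<alpha> (1 * t) / dunkl_I \<nu> t = 1 + t / (2 * \<nu>) * (deriv (dunkl_I \<nu>) t / dunkl_I \<nu> t) + t / (2 * \<nu>)"
            using I by (simp add: E I\<alpha> add_divide_distrib)
          also have "norm \<dots> \<le> 1 + X N / norm \<nu> * \<bar>C\<bar> + X N / norm \<nu>"
            using prod tn by (intro norm_triangle_mono) simp_all
          also have "\<dots> \<le> (1 + \<bar>C\<bar> / norm \<nu> + 1 / norm \<nu>) * X N"
            using elim by (simp add: distrib_right distrib_left mult.commute[of "X N"])
          finally have num: "norm (dunkl_E \<alpha> (1 * t) / dunkl_I \<nu> t) \<le> (1 + \<bar>C\<bar> / norm \<nu> + 1 / norm \<nu>) * X N" .
          have "norm (dunkl_E \<alpha> (1 * t) / dunkl_I \<nu> t / t ^ Suc (2 * k)) \<le> (1 + \<bar>C\<bar> / norm \<nu> + 1 / norm \<nu>) * X N / X N ^ Suc (2 * k)"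
            unfolding norm_divide[of _ "t ^ Suc (2 * k)"] norm_power
            using num norm_sq(1)[OF t] elim \<nu>0 by (intro frac_le power_mono) (auto intro!: mult_nonneg_nonneg add_nonneg_nonneg)
          also have "X N ^ Suc (2 * k) = X N powr (2 * real k + 1)"
            using elim powr_realpow[of "X N" "Suc (2 * k)"] by (simp add: add_ac)
          finally show "norm (dunkl_E \<alpha> (1 * t) / dunkl_I \<nu> t / t ^ Suc (2 * k)) \<le> B N"
            by (simp only: B_def powr_minus divide_inverse)
        qed
      qed
      show "dunkl_E \<alpha> (1 * t) / (deriv (dunkl_I \<nu>) t * t ^ Suc (2 * k)) = a t" if "dunkl_I \<nu> t = 0" for t
        using I\<alpha>_zero[OF that] that by (simp add: E a_def)
      show "a (- t) = a t" for t by (simp add: a_def)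
      have "summable (\<lambda>j. 1 / (2 * norm \<nu>) * norm (r j) powr - (2 * real k))"
        using k by (intro summable_mult summable_powr_r) auto
      moreover have "norm (a (r j)) = 1 / (2 * norm \<nu>) * norm (r j) powr - (2 * real k)" for j
      proof -
        have "norm (r j) > 0" using I\<alpha>_zero(2)[OF r_zero] by simp
        then show ?thesis using powr_realpow[of "norm (r j)" "2 * k"]
          by (simp add: a_def norm_divide norm_mult norm_power powr_minus field_simps)
      qed
      ultimately show "summable (\<lambda>j. norm (a (r j)))" by simp
    qed
    then show "((\<lambda>j::nat. 1 / s (int j + 1) ^ (2 * k)) sums
            ((-1) ^ (k + 1) / (2 ^ (2 * k) * fact k * pochhammer (\<alpha> + 2) (k - 1))
              * bernoulli_dunkl \<alpha> (2 * k) 1))"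
    proof (rule result)
      show "2 * a (r j) = (-1) ^ k / \<nu> * (1 / s (int j + 1) ^ (2 * k))" for j
        unfolding a_def r_pow by (rule sgn)
    qed
  next
    assume Re\<alpha>: "Re \<alpha> < 2 * real k - 3 / 2"
    define p where "p = Re \<nu> + 1 / 2"
    \<comment> \<open>The only form in which the condition on Re \<alpha> enters: for the decay of
      the contour integral, of order X^(p - 2k), and for absolute convergence.\<close>
    have p: "p < 2 * real k" using Re\<alpha> by (simp add: p_def \<nu>_def)
    have E1: "dunkl_E \<alpha> (0 * t) = 1" for t
      using dunkl_I_0[OF \<alpha>(1)] by (simp add: dunkl_E_def)
    \<comment> \<open>With h = 1 the derivative stays in the residue. At a zero, t times the
      derivative equals 2 \<nu> \<open>dunkl_I \<alpha> t\<close>, which uses up one power of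
      t.\<close>
    define a where "a = (\<lambda>t. 1 / (2 * \<nu> * (dunkl_I \<alpha> t * t ^ (2 * k))))"
    have "(\<lambda>j. 2 * a (r j)) sums - fps_nth (fps_expansion (\<lambda>t. dunkl_E \<alpha> (0 * t) / dunkl_I \<nu> t) 0) (2 * k)"
    proof (rule zero_sum)
      show "(\<lambda>t. dunkl_E \<alpha> (0 * t)) holomorphic_on UNIV" unfolding E1 by simp
      show "dunkl_E \<alpha> (0 * t) \<noteq> 0" for t unfolding E1 by simp
      \<comment> \<open>On the square X \<le> |t| \<le> 2 X: the summand 2^p serves p \<ge> 0, the
        summand 1 serves p < 0.\<close>
      define M where "M = 1 + 2 powr p"
      have M: "M > 0" by (simp add: M_def add_pos_pos)
      define B where "B = (\<lambda>N. M / \<delta> * X N powr p * X N powr - (2 * real k + 1))"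
      have "filterlim (\<lambda>N. X N powr (p - 2 * real k)) (nhds 0) sequentially"
        using p X_at_top by (intro tendsto_neg_powr) auto
      then have "((\<lambda>N. M / \<delta> * X N powr (p - 2 * real k)) \<longlongrightarrow> 0) sequentially"
        by (rule tendsto_mult_right_zero)
      then show "((\<lambda>N. X N * B N) \<longlongrightarrow> 0) sequentially"
      proof (rule Lim_transform_eventually)
        show "\<forall>\<^sub>F N in sequentially. M / \<delta> * X N powr (p - 2 * real k) = X N * B N"
          using X1
        proof eventually_elim
          case (elim N)
          have "X N powr (p - 2 * real k) = X N powr (1 + p + - (2 * real k + 1))" by simp
          also have "\<dots> = X N * X N powr p * X N powr - (2 * real k + 1)"
            unfolding powr_add using elim by simp
          finally show ?case by (simp add: B_def)
        qed
      qed
      show "\<forall>\<^sub>F N in sequentially. \<forall>t. max \<bar>Re t\<bar> \<bar>Im t\<bar> = X N \<longrightarrow>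
          norm (dunkl_E \<alpha> (0 * t) / dunkl_I \<nu> t / t ^ Suc (2 * k)) \<le> B N"
        using X1
      proof eventually_elim
        case (elim N)
        show ?case
        proof (intro allI impI)
          fix t assume t: "max \<bar>Re t\<bar> \<bar>Im t\<bar> = X N"
          have nt: "norm t > 0" "X N > 0" using norm_sq(1)[OF t] elim by linarith+
          have I: "dunkl_I \<nu> t \<noteq> 0" using nz t elim by blast
          have "norm t powr p \<le> M * X N powr p"
          proof (cases "p \<ge> 0")
            case True
            have "norm t powr p \<le> (2 * X N) powr p"
              using norm_sq(2)[OF t] True by (intro powr_mono2) auto
            also have "\<dots> \<le> M * X N powr p" by (simp add: M_def powr_mult distrib_right)
            finally show ?thesis .
          next
            case False
            then have "norm t powr p \<le> X N powr p"
              using norm_sq(1)[OF t] nt by (intro powr_mono2') auto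
            also have "\<dots> \<le> M * X N powr p" by (simp add: M_def distrib_right)
            finally show ?thesis .
          qed
          moreover have "1 / norm (dunkl_I \<nu> t) \<le> norm t powr p / \<delta>"
            using lower[of N t] t elim I \<delta> nt by (simp add: p_def[symmetric] powr_minus field_simps)
          ultimately have "norm (1 / dunkl_I \<nu> t) \<le> M / \<delta> * X N powr p"
            using \<delta> by (simp add: norm_divide) (smt (verit) divide_right_mono)
          then have "norm (1 / dunkl_I \<nu> t / t ^ Suc (2 * k)) \<le> M / \<delta> * X N powr p / X N ^ Suc (2 * k)"
            unfolding norm_divide[of _ "t ^ Suc (2 * k)"] norm_power
            using norm_sq(1)[OF t] nt M \<delta> by (intro frac_le power_mono) auto
          also have "X N ^ Suc (2 * k) = X N powr (2 * real k + 1)"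
            using elim powr_realpow[of "X N" "Suc (2 * k)"] by (simp add: add_ac)
          finally show "norm (dunkl_E \<alpha> (0 * t) / dunkl_I \<nu> t / t ^ Suc (2 * k)) \<le> B N"
            by (simp only: E1 B_def powr_minus divide_inverse)
        qed
      qed
      show "dunkl_E \<alpha> (0 * t) / (deriv (dunkl_I \<nu>) t * t ^ Suc (2 * k)) = a t" if "dunkl_I \<nu> t = 0" for t
        using I\<alpha>_zero[OF that] \<nu>0 unfolding E1 a_def I\<alpha>_zero(1)[OF that] by (simp add: field_simps)
      show "a (- t) = a t" for t by (simp add: a_def dunkl_I_minus)
      \<comment> \<open>By the lower bound for the derivative at the zeros, the terms are O(|r j|^(p
        - 2k - 1)), and q > 1 is p < 2k once more.\<close>
      define q where "q = 2 * real k + 1 - p"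
      have sm: "summable (\<lambda>j. 1 / \<delta> * norm (r j) powr - q)"
        using p by (intro summable_mult summable_powr_r) (simp add: q_def)
      have "norm (norm (a (r j))) \<le> 1 / \<delta> * norm (r j) powr - q" if j: "Im (r j) \<ge> X N0" for j
      proof -
        note z = I\<alpha>_zero[OF r_zero[of j]]
        have nr: "norm (r j) > 0" using z by simp
        have pw: "norm (r j) powr - q = norm (r j) powr p / norm (r j) ^ (2 * k + 1)"
        proof -
          have "norm (r j) ^ (2 * k + 1) = norm (r j) powr (2 * real k + 1)"
            using nr powr_realpow[of "norm (r j)" "2 * k + 1"] by (simp add: add_ac)
          moreover have "- q = p - (2 * real k + 1)" by (simp add: q_def)
          ultimately show ?thesis by (simp only: powr_diff)
        qed
        have "1 / norm (deriv (dunkl_I \<nu>) (r j)) \<le> norm (r j) powr p / \<delta>"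
          using simple[OF r_zero, of j] j z(3) \<delta> nr by (simp add: p_def[symmetric] powr_minus field_simps)
        then have "1 / norm (deriv (dunkl_I \<nu>) (r j)) / norm (r j) ^ (2 * k + 1) \<le> norm (r j) powr p / \<delta> / norm (r j) ^ (2 * k + 1)"
          by (rule divide_right_mono) simp
        moreover have "a (r j) = 1 / deriv (dunkl_I \<nu>) (r j) / r j ^ (2 * k + 1)"
          using z \<nu>0 unfolding a_def z(1) by (simp add: field_simps)
        ultimately show ?thesis
          unfolding pw by (simp add: norm_divide norm_mult norm_power mult_ac)
      qed
      moreover have ev: "\<forall>\<^sub>F j in sequentially. Im (r j) \<ge> X N0"
        using r_at_top by (auto simp: filterlim_at_top)
      ultimately show "summable (\<lambda>j. norm (a (r j)))"
        by (intro summable_comparison_test_ev[OF eventually_mono[OF ev] sm])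
    qed
    then show "((\<lambda>j::nat. 1 / (dunkl_I \<alpha> (\<i> * s (int j + 1)) * s (int j + 1) ^ (2 * k))) sums
            ((-1) ^ (k + 1) / (2 ^ (2 * k) * fact k * pochhammer (\<alpha> + 2) (k - 1))
              * bernoulli_dunkl \<alpha> (2 * k) 0))"
    proof (rule result)
      show "2 * a (r j) = (-1) ^ k / \<nu> * (1 / (dunkl_I \<alpha> (\<i> * s (int j + 1)) * s (int j + 1) ^ (2 * k)))" for j
        unfolding a_def r_pow r_def[symmetric] mult.left_commute[of "dunkl_I \<alpha> (r j)"] by (rule sgn)
    qed
  qed
qed

end
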